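(* Let $G$ be a finite simple undirected graph. Then $G$ is a clique-sum of graphs from $\mathcal{F}$ if and only if $G$ does not have any of the graphs $C_n$, $n\ge 5$, and $D_1,D_2,D_3,D_4$ as an induced subgraph.
   Context: $C_n$, $P_n$, $K_n$ denote the cycle, path and complete graph on $n$ vertices, $\overline{G}$ the complement of $G$, and $\sqcup$ disjoint union. The graphs $D_1,\dots,D_4$ are given by their complements: $\overline{D}_1=P_6$, $\overline{D}_2=C_6$, $\overline{D}_3=P_4\sqcup K_2$, $\overline{D}_4=K_3\sqcup K_2$. For an integer $k\ge 0$, $\mathcal{F}_k$ is the class of graphs whose vertex set can be partitioned into cliques $X_1,Y_1,\dots,X_k,Y_k,Z$, with $X_j\neq\emptyset$ and $Y_j\ne\emptyset$ for $j=1,\dots,k$ and $Z$ possibly empty, such that two vertices lying in different parts are non-adjacent if and only if, for some $j$, one lies in $X_j$ and the other in $Y_j$. Set $\mathcal{F}=\bigcup_{k=0}^\infty\mathcal{F}_k$. If graphs $G_1=(V_1,E_1)$ and $G_2=(V_2,E_2)$ each have a clique of the same cardinality (possibly $0$), a clique-sum of $G_1$ and $G_2$ is the graph $(V_1\cup V_2,E_1\cup E_2)$ obtained by identifying the vertices of these two cliques (no edges are removed). Clique-sums of more than two graphs are defined inductively; a single graph counts as a clique-sum of itself. *)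

theory Defs
  imports Main "HOL-Library.Disjoint_Sets"
begin

datatype 'a graph = Graph (verts: "'a set") (edges: "'a set set")

definition finite_simple_graph :: "'a graph \<Rightarrow> bool" where
  "finite_simple_graph G \<longleftrightarrow>
     finite (verts G) \<and> (\<forall>e\<in>edges G. e \<subseteq> verts G \<and> card e = 2)"

definition adjacent :: "'a graph \<Rightarrow> 'a \<Rightarrow> 'a \<Rightarrow> bool" where
  "adjacent G u v \<longleftrightarrow> {u, v} \<in> edges G"

definition clique :: "'a graph \<Rightarrow> 'a set \<Rightarrow> bool" where
  "clique G K \<longleftrightarrow>
     K \<subseteq> verts G \<and> (\<forall>u\<in>K. \<forall>v\<in>K. u \<noteq> v \<longrightarrow> adjacent G u v)"

definition complete_graph :: "nat \<Rightarrow> nat graph" where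
  "complete_graph n = Graph {..<n} {{i, j} | i j. i < n \<and> j < n \<and> i \<noteq> j}"

definition path_graph :: "nat \<Rightarrow> nat graph" where
  "path_graph n = Graph {..<n} {{i, Suc i} | i. Suc i < n}"

text \<open>Only meaningful for \<open>n \<ge> 3\<close>.\<close>
definition cycle_graph :: "nat \<Rightarrow> nat graph" where
  "cycle_graph n = Graph {..<n} {{i, Suc i mod n} | i. i < n}"

definition complement :: "'a graph \<Rightarrow> 'a graph" where
  "complement G =
     Graph (verts G)
       {{u, v} | u v. u \<in> verts G \<and> v \<in> verts G \<and> u \<noteq> v \<and> \<not> adjacent G u v}"

definition graph_image :: "('a \<Rightarrow> 'b) \<Rightarrow> 'a graph \<Rightarrow> 'b graph" where
  "graph_image f G = Graph (f ` verts G) ((\<lambda>e. f ` e) ` edges G)"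

definition graph_union :: "'a graph \<Rightarrow> 'a graph \<Rightarrow> 'a graph" where
  "graph_union G H = Graph (verts G \<union> verts H) (edges G \<union> edges H)"

definition disjoint_union :: "'a graph \<Rightarrow> 'b graph \<Rightarrow> ('a + 'b) graph" where
  "disjoint_union G H = graph_union (graph_image Inl G) (graph_image Inr H)"

definition induced_subgraph :: "'a graph \<Rightarrow> 'a set \<Rightarrow> 'a graph" where
  "induced_subgraph G S = Graph S {e \<in> edges G. e \<subseteq> S}"

definition isomorphic :: "'a graph \<Rightarrow> 'b graph \<Rightarrow> bool" where
  "isomorphic G H \<longleftrightarrow>
     (\<exists>f. bij_betw f (verts G) (verts H) \<and>
        (\<forall>u\<in>verts G. \<forall>v\<in>verts G. adjacent G u v \<longleftrightarrow> adjacent H (f u) (f v)))"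

definition has_induced_subgraph :: "'a graph \<Rightarrow> 'b graph \<Rightarrow> bool" where
  "has_induced_subgraph G H \<longleftrightarrow>
     (\<exists>S\<subseteq>verts G. isomorphic H (induced_subgraph G S))"

definition D1 :: "nat graph" where
  "D1 = complement (path_graph 6)"

definition D2 :: "nat graph" where
  "D2 = complement (cycle_graph 6)"

definition D3 :: "(nat + nat) graph" where
  "D3 = complement (disjoint_union (path_graph 4) (complete_graph 2))"

definition D4 :: "(nat + nat) graph" where
  "D4 = complement (disjoint_union (complete_graph 3) (complete_graph 2))"

text \<open>Names for the parts \<open>X\<^sub>1, Y\<^sub>1, \<dots>, X\<^sub>k, Y\<^sub>k, Z\<close> of the partition in the definition of
  \<open>F_class k\<close>. The partition is a family of sets indexed by these names, so that parts with
  different names are different parts even before disjointness is imposed.\<close>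
datatype part = X nat | Y nat | Z

definition part_names :: "nat \<Rightarrow> part set" where
  "part_names k = X ` {1..k} \<union> Y ` {1..k} \<union> {Z}"

definition F_class :: "nat \<Rightarrow> 'a graph set" where
  "F_class k =
     {G. finite_simple_graph G \<and>
        (\<exists>P :: part \<Rightarrow> 'a set.
           (\<Union>p\<in>part_names k. P p) = verts G \<and>
           disjoint_family_on P (part_names k) \<and>
           (\<forall>p\<in>part_names k. clique G (P p)) \<and>
           (\<forall>j\<in>{1..k}. P (X j) \<noteq> {} \<and> P (Y j) \<noteq> {}) \<and>
           (\<forall>p\<in>part_names k. \<forall>q\<in>part_names k. p \<noteq> q \<longrightarrow>
              (\<forall>u\<in>P p. \<forall>v\<in>P q.
                 \<not> adjacent G u v \<longleftrightarrow>
                 (\<exists>j\<in>{1..k}. u \<in> P (X j) \<and> v \<in> P (Y j) \<or>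
                              v \<in> P (X j) \<and> u \<in> P (Y j)))))}"

definition F_all :: "'a graph set" where
  "F_all = (\<Union>k. F_class k)"

text \<open>\<open>G\<close> arises from \<open>G\<^sub>1\<close> and \<open>G\<^sub>2\<close> by identifying the clique \<open>K\<^sub>1\<close> of \<open>G\<^sub>1\<close> with the clique
  \<open>K\<^sub>2\<close> of \<open>G\<^sub>2\<close>: \<open>f\<^sub>1\<close> and \<open>f\<^sub>2\<close> place the vertices of \<open>G\<^sub>1\<close> and \<open>G\<^sub>2\<close> in \<open>G\<close>, and two vertices have
  the same place only as prescribed by the identification of \<open>K\<^sub>1\<close> with \<open>K\<^sub>2\<close>.\<close>
definition is_clique_sum :: "'a graph \<Rightarrow> 'b graph \<Rightarrow> 'c graph \<Rightarrow> bool" where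
  "is_clique_sum G\<^sub>1 G\<^sub>2 G \<longleftrightarrow>
     (\<exists>K\<^sub>1 K\<^sub>2 f\<^sub>1 f\<^sub>2.
        clique G\<^sub>1 K\<^sub>1 \<and> clique G\<^sub>2 K\<^sub>2 \<and> card K\<^sub>1 = card K\<^sub>2 \<and>
        inj_on f\<^sub>1 (verts G\<^sub>1) \<and> inj_on f\<^sub>2 (verts G\<^sub>2) \<and>
        f\<^sub>1 ` K\<^sub>1 = f\<^sub>2 ` K\<^sub>2 \<and>
        f\<^sub>1 ` verts G\<^sub>1 \<inter> f\<^sub>2 ` verts G\<^sub>2 = f\<^sub>1 ` K\<^sub>1 \<and>
        G = graph_union (graph_image f\<^sub>1 G\<^sub>1) (graph_image f\<^sub>2 G\<^sub>2))"

text \<open>All clique-sums of finitely many (at least one) graphs from \<open>\<C>\<close>. Keeping the summands in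
  the vertex type of the sum loses no generality when \<open>\<C>\<close> is closed under isomorphism: every
  summand has a copy inside the sum.\<close>
inductive_set clique_sums :: "'a graph set \<Rightarrow> 'a graph set" for \<C> :: "'a graph set" where
  single: "G \<in> \<C> \<Longrightarrow> G \<in> clique_sums \<C>"
| glue: "G\<^sub>1 \<in> clique_sums \<C> \<Longrightarrow> G\<^sub>2 \<in> clique_sums \<C> \<Longrightarrow> is_clique_sum G\<^sub>1 G\<^sub>2 G
    \<Longrightarrow> G \<in> clique_sums \<C>"

end

theory Submission
  imports Defs
begin

text \<open>
  The idea is to look at the complement. A graph lies in \<open>\<F>\<close> iff every component of its
  complement is complete bipartite or a single vertex, and this holds iff the relation \<open>N\<close> of
  being distinct and non-adjacent satisfies: \<open>N a b\<close>, \<open>N b c\<close> and \<open>N c d\<close> imply \<open>N a d\<close>. Such a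
  relation is called difunctional; for \<open>a = d\<close> the law excludes a triangle of \<open>N\<close>, and otherwise,
  once there are no triangles, it excludes an induced path on four vertices. This is
  \<open>F_all_iff_difunctional\<close>.

  A clique-sum contains no forbidden graph, because members of \<open>\<F>\<close> contain none and because no
  forbidden graph has a clique cutset (\<open>obstruction_clique_cutset_free\<close>): an induced copy in a sum
  of two graphs would be separated by the common clique unless it lies in one of them.

  Conversely, let \<open>G\<close> avoid the forbidden graphs. By induction on the number of vertices it is
  enough to show that \<open>G\<close> is in \<open>\<F>\<close> or has a possibly empty clique whose removal leaves a
  disconnected graph (\<open>proper_separation_exists\<close>); cutting along that clique writes \<open>G\<close> as a
  clique-sum of two proper induced subgraphs. Suppose that there is no such clique, that \<open>G\<close> is not
  in \<open>\<F>\<close>, and that \<open>N a b\<close>. Let \<open>K\<close> be the component of \<open>b\<close> after removal of \<open>a\<close> and its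
  neighbours. The neighbours of \<open>a\<close> to which \<open>K\<close> is attached do not form a clique, so two
  non-adjacent ones are joined by an induced path through \<open>K\<close>. With \<open>a\<close> it closes up to an induced
  cycle, which must have length four (\<open>four_cycle_exists\<close>).

  Now let \<open>W\<close> be a maximal set of vertices that contains this four-cycle and on which \<open>N\<close> is
  difunctional. If \<open>W\<close> is everything, \<open>G\<close> is in \<open>\<F>\<close>. Otherwise some component outside \<open>W\<close> is
  attached to two non-adjacent vertices \<open>u\<close>, \<open>v\<close> of \<open>W\<close>, and a shortest path between two such
  vertices through the outside is considered, over all choices of \<open>u\<close> and \<open>v\<close>. As \<open>W\<close> contains a
  four-cycle, its complement has an edge \<open>x y\<close> in another component than \<open>u v\<close>, so \<open>x\<close> and \<open>y\<close> are
  adjacent to both \<open>u\<close> and \<open>v\<close>. A path with two or more inner vertices then yields an induced cycle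
  of length at least five or the prism, which is \<open>D2\<close> (\<open>single_vertex_if_apart_edge\<close>). If there is
  only one inner vertex \<open>w\<close>, the absence of \<open>D1\<close>, \<open>D3\<close> and \<open>D4\<close> forces \<open>N\<close> to be difunctional on
  \<open>W\<close> with \<open>w\<close> added (\<open>difunctional_insert\<close>), against the maximality of \<open>W\<close>.
\<close>

section \<open>Non-adjacency and induced patterns\<close>

definition nonadj :: "'a graph \<Rightarrow> 'a \<Rightarrow> 'a \<Rightarrow> bool" where
  "nonadj G u v \<longleftrightarrow> u \<in> verts G \<and> v \<in> verts G \<and> u \<noteq> v \<and> \<not> adjacent G u v"

lemma adjacent_commute: "adjacent G u v \<longleftrightarrow> adjacent G v u"
  by (simp add: adjacent_def insert_commute)

lemma adjacentD:
  assumes "finite_simple_graph G" "adjacent G u v"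
  shows "u \<in> verts G" "v \<in> verts G" "u \<noteq> v"
proof -
  have "{u, v} \<subseteq> verts G" "card {u, v} = 2"
    using assms by (auto simp: finite_simple_graph_def adjacent_def)
  then show "u \<in> verts G" "v \<in> verts G" "u \<noteq> v" by auto
qed

lemma nonadj_commute: "nonadj G u v \<longleftrightarrow> nonadj G v u"
  by (auto simp: nonadj_def adjacent_commute)

lemma nonadj_irrefl [simp]: "\<not> nonadj G u u"
  by (simp add: nonadj_def)

lemma nonadj_verts: "nonadj G u v \<Longrightarrow> u \<in> verts G \<and> v \<in> verts G"
  by (simp add: nonadj_def)

lemma adjacent_iff_not_nonadj:
  "u \<in> verts G \<Longrightarrow> v \<in> verts G \<Longrightarrow> u \<noteq> v \<Longrightarrow> adjacent G u v \<longleftrightarrow> \<not> nonadj G u v"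
  by (simp add: nonadj_def)

lemma adjacent_induced_subgraph:
  "adjacent (induced_subgraph G S) u v \<longleftrightarrow> adjacent G u v \<and> u \<in> S \<and> v \<in> S"
  by (auto simp: adjacent_def induced_subgraph_def)

lemma verts_induced_subgraph [simp]: "verts (induced_subgraph G S) = S"
  by (simp add: induced_subgraph_def)

lemma finite_simple_induced_subgraph:
  "finite_simple_graph G \<Longrightarrow> S \<subseteq> verts G \<Longrightarrow> finite_simple_graph (induced_subgraph G S)"
  by (auto simp: finite_simple_graph_def induced_subgraph_def intro: finite_subset)

text \<open>
  All forbidden graphs are treated uniformly as patterns on \<open>{..<n}\<close>: \<open>R i j\<close> says whether the
  positions \<open>i < j\<close> are adjacent.
\<close>
definition induces :: "'a graph \<Rightarrow> 'a list \<Rightarrow> (nat \<Rightarrow> nat \<Rightarrow> bool) \<Rightarrow> bool" where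
  "induces G xs R \<longleftrightarrow> distinct xs \<and> set xs \<subseteq> verts G \<and>
     (\<forall>j<length xs. \<forall>i<j. adjacent G (xs ! i) (xs ! j) \<longleftrightarrow> R i j)"

lemma has_induced_subgraph_iff_induces:
  fixes G :: "'a graph" and H :: "'b graph"
  assumes "finite_simple_graph G"
    and h: "bij_betw h {..<n} (verts H)"
    and R: "\<And>i j. i < j \<Longrightarrow> j < n \<Longrightarrow> adjacent H (h i) (h j) \<longleftrightarrow> R i j"
    and loop: "\<And>i. i < n \<Longrightarrow> \<not> adjacent H (h i) (h i)"
  shows "has_induced_subgraph G H \<longleftrightarrow> (\<exists>xs. length xs = n \<and> induces G xs R)"
proof
  assume "has_induced_subgraph G H"
  then obtain S f where S: "S \<subseteq> verts G" and f: "bij_betw f (verts H) S"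
    and a: "\<And>u v. u \<in> verts H \<Longrightarrow> v \<in> verts H \<Longrightarrow>
      adjacent H u v \<longleftrightarrow> adjacent (induced_subgraph G S) (f u) (f v)"
    unfolding has_induced_subgraph_def isomorphic_def by auto
  have fh: "bij_betw (f \<circ> h) {..<n} S"
    using h f by (rule bij_betw_trans)
  let ?xs = "map (f \<circ> h) [0..<n]"
  have "distinct ?xs"
    using fh by (simp add: distinct_map bij_betw_def atLeast0LessThan)
  moreover have set: "set ?xs = S"
    using fh by (simp add: bij_betw_def atLeast0LessThan)
  moreover have "adjacent G (?xs ! i) (?xs ! j) \<longleftrightarrow> R i j" if "j < n" "i < j" for i j
  proof -
    have "h i \<in> verts H" "h j \<in> verts H" using h that by (auto simp: bij_betw_def)
    moreover from this have "f (h i) \<in> S" "f (h j) \<in> S" using f by (auto simp: bij_betw_def)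
    ultimately show ?thesis
      using a[of "h i" "h j"] R[of i j] that by (simp add: adjacent_induced_subgraph)
  qed
  ultimately have "induces G ?xs R" using S by (simp add: induces_def)
  then show "\<exists>xs. length xs = n \<and> induces G xs R" by (intro exI[of _ ?xs]) simp
next
  assume "\<exists>xs. length xs = n \<and> induces G xs R"
  then obtain xs where xs: "length xs = n" "induces G xs R" by blast
  define g where "g = inv_into {..<n} h"
  have g: "bij_betw g (verts H) {..<n}"
    unfolding g_def using h by (rule bij_betw_inv_into)
  have hg: "h (g u) = u" if "u \<in> verts H" for u
    unfolding g_def using h that by (simp add: bij_betw_inv_into_right)
  have "bij_betw (\<lambda>i. xs ! i) {..<n} (set xs)"
    using xs by (auto simp: induces_def intro: bij_betw_nth)
  with g have bij: "bij_betw (\<lambda>u. xs ! g u) (verts H) (set xs)"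
    using bij_betw_trans[of g "verts H" "{..<n}" "(!) xs" "set xs"] by (simp add: comp_def)
  have "adjacent H u v \<longleftrightarrow> adjacent G (xs ! g u) (xs ! g v)"
    if uv: "u \<in> verts H" "v \<in> verts H" for u v
  proof -
    have lt: "g u < n" "g v < n" using g uv by (auto simp: bij_betw_def)
    consider "g u < g v" | "g u = g v" | "g v < g u" by linarith
    then show ?thesis
    proof cases
      case 1
      then show ?thesis
        using R[of "g u" "g v"] lt hg uv xs by (simp add: induces_def)
    next
      case 2
      then have "u = v" using hg uv by metis
      then show ?thesis
        using loop[of "g u"] lt hg uv adjacentD(3)[OF assms(1)] by metis
    next
      case 3
      then show ?thesis
        using R[of "g v" "g u"] lt hg uv xs
        by (simp add: induces_def adjacent_commute[of H u] adjacent_commute[of G "xs ! g u"])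
    qed
  qed
  moreover have "xs ! g u \<in> set xs" if "u \<in> verts H" for u
    using bij that by (auto simp: bij_betw_def)
  ultimately have "isomorphic H (induced_subgraph G (set xs))"
    using bij unfolding isomorphic_def
    by (intro exI[of _ "\<lambda>u. xs ! g u"]) (auto simp: adjacent_induced_subgraph)
  then show "has_induced_subgraph G H"
    using xs by (auto simp: has_induced_subgraph_def induces_def)
qed

definition cycle_pattern :: "nat \<Rightarrow> nat \<Rightarrow> nat \<Rightarrow> bool" where
  "cycle_pattern n i j \<longleftrightarrow> j = Suc i \<or> i = 0 \<and> j = n - 1"

text \<open>
  The patterns of the cycles and of the complements of \<open>P\<^sub>6\<close>, \<open>C\<^sub>6\<close>, \<open>P\<^sub>4 \<squnion> K\<^sub>2\<close> (with the path on
  \<open>0, 1, 2, 3\<close>) and \<open>K\<^sub>3 \<squnion> K\<^sub>2\<close> (with the triangle on \<open>0, 1, 2\<close>).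
\<close>
inductive obstruction :: "nat \<Rightarrow> (nat \<Rightarrow> nat \<Rightarrow> bool) \<Rightarrow> bool" where
  cycle: "n \<ge> 5 \<Longrightarrow> obstruction n (cycle_pattern n)"
| co_P6: "obstruction 6 (\<lambda>i j. j \<noteq> Suc i)"
| co_C6: "obstruction 6 (\<lambda>i j. \<not> cycle_pattern 6 i j)"
| co_P4_K2: "obstruction 6 (\<lambda>i j. \<not> (j = Suc i \<and> i \<noteq> 3))"
| co_K3_K2: "obstruction 5 (\<lambda>i j. i < 3 \<and> 3 \<le> j)"

definition obstruction_free :: "'a graph \<Rightarrow> bool" where
  "obstruction_free G \<longleftrightarrow> (\<forall>xs R. obstruction (length xs) R \<longrightarrow> \<not> induces G xs R)"

lemma adjacent_complement:
  "adjacent (complement H) u v \<longleftrightarrow> u \<in> verts H \<and> v \<in> verts H \<and> u \<noteq> v \<and> \<not> adjacent H u v"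
  by (auto simp: adjacent_def complement_def doubleton_eq_iff insert_commute)

lemma adjacent_path_graph:
  "adjacent (path_graph n) i j \<longleftrightarrow> i < n \<and> j < n \<and> (j = Suc i \<or> i = Suc j)"
  by (auto simp: adjacent_def path_graph_def doubleton_eq_iff)

lemma adjacent_cycle_graph_mod:
  "n > 0 \<Longrightarrow> adjacent (cycle_graph n) i j \<longleftrightarrow>
    i < n \<and> j < n \<and> (j = Suc i mod n \<or> i = Suc j mod n)"
  by (auto simp: adjacent_def cycle_graph_def doubleton_eq_iff)

lemma adjacent_cycle_graph:
  "i < j \<Longrightarrow> j < n \<Longrightarrow> adjacent (cycle_graph n) i j \<longleftrightarrow> cycle_pattern n i j"
  by (auto simp: adjacent_cycle_graph_mod cycle_pattern_def mod_Suc)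

lemma not_adjacent_cycle_graph_self:
  "n \<ge> 3 \<Longrightarrow> \<not> adjacent (cycle_graph n) i i"
  by (auto simp: adjacent_cycle_graph_mod mod_Suc)

lemma adjacent_disjoint_union:
  "adjacent (disjoint_union G H) (Inl i) (Inl j) \<longleftrightarrow> adjacent G i j"
  "adjacent (disjoint_union G H) (Inr k) (Inr l) \<longleftrightarrow> adjacent H k l"
  "\<not> adjacent (disjoint_union G H) (Inl i) (Inr l)"
proof -
  have inl: "{Inl i, Inl j} = Inl ` e \<longleftrightarrow> e = {i, j}" for i j :: 'a and e
    using inj_image_eq_iff[of Inl "{i, j}" e] by auto
  have inr: "{Inr i, Inr j} = Inr ` e \<longleftrightarrow> e = {i, j}" for i j :: 'b and e
    using inj_image_eq_iff[of Inr "{i, j}" e] by auto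
  have no: "{Inl i, x} \<noteq> Inr ` e" "{x, Inr l} \<noteq> Inl ` d" for i :: 'a and l :: 'b and x e d
    by auto
  show "adjacent (disjoint_union G H) (Inl i) (Inl j) \<longleftrightarrow> adjacent G i j"
    "adjacent (disjoint_union G H) (Inr k) (Inr l) \<longleftrightarrow> adjacent H k l"
    "\<not> adjacent (disjoint_union G H) (Inl i) (Inr l)"
    by (auto simp: adjacent_def disjoint_union_def graph_union_def graph_image_def
        image_iff inl inr no)
qed

lemma adjacent_complete_graph:
  "adjacent (complete_graph n) i j \<longleftrightarrow> i < n \<and> j < n \<and> i \<noteq> j"
  by (auto simp: adjacent_def complete_graph_def doubleton_eq_iff)

lemma verts_named_graphs:
  "verts (complete_graph n) = {..<n}" "verts (path_graph n) = {..<n}"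
  "verts (cycle_graph n) = {..<n}" "verts (complement H) = verts H"
  "verts (disjoint_union K L) = Inl ` verts K \<union> Inr ` verts L"
  by (auto simp: complete_graph_def path_graph_def cycle_graph_def complement_def
      disjoint_union_def graph_union_def graph_image_def)

lemma bij_betw_split_sum:
  "bij_betw (\<lambda>i. if i < m then Inl i else Inr (i - m)) {..<m + k}
     (Inl ` {..<m} \<union> Inr ` {..<k} :: (nat + nat) set)"
  by (rule bij_betw_byWitness[where f' = "case_sum id (\<lambda>i. i + m)"]) auto

lemma obstruction_free_iff:
  fixes G :: "'a graph"
  assumes G: "finite_simple_graph G"
  shows "obstruction_free G \<longleftrightarrow>
    (\<forall>n\<ge>5. \<not> has_induced_subgraph G (cycle_graph n)) \<and>
    \<not> has_induced_subgraph G D1 \<and>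
    \<not> has_induced_subgraph G D2 \<and>
    \<not> has_induced_subgraph G D3 \<and>
    \<not> has_induced_subgraph G D4"
proof -
  have cyc: "has_induced_subgraph G (cycle_graph n) \<longleftrightarrow>
      (\<exists>xs. length xs = n \<and> induces G xs (cycle_pattern n))" if "n \<ge> 5" for n
    by (rule has_induced_subgraph_iff_induces[OF G, where h = id])
      (use that in \<open>auto simp: verts_named_graphs adjacent_cycle_graph
        not_adjacent_cycle_graph_self\<close>)
  have d1: "has_induced_subgraph G D1 \<longleftrightarrow>
      (\<exists>xs. length xs = 6 \<and> induces G xs (\<lambda>i j. j \<noteq> Suc i))"
    by (rule has_induced_subgraph_iff_induces[OF G, where h = id])
      (auto simp: D1_def verts_named_graphs adjacent_complement adjacent_path_graph)
  have d2: "has_induced_subgraph G D2 \<longleftrightarrow>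
      (\<exists>xs. length xs = 6 \<and> induces G xs (\<lambda>i j. \<not> cycle_pattern 6 i j))"
    by (rule has_induced_subgraph_iff_induces[OF G, where h = id])
      (auto simp: D2_def verts_named_graphs adjacent_complement adjacent_cycle_graph)
  have d3: "has_induced_subgraph G D3 \<longleftrightarrow>
      (\<exists>xs. length xs = 6 \<and> induces G xs (\<lambda>i j. \<not> (j = Suc i \<and> i \<noteq> 3)))"
    by (rule has_induced_subgraph_iff_induces[OF G,
          where h = "\<lambda>i. if i < 4 then Inl i else Inr (i - 4)"])
      (use bij_betw_split_sum[of 4 2] in \<open>auto simp: D3_def verts_named_graphs
        adjacent_complement adjacent_disjoint_union adjacent_path_graph adjacent_complete_graph\<close>)
  have d4: "has_induced_subgraph G D4 \<longleftrightarrow>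
      (\<exists>xs. length xs = 5 \<and> induces G xs (\<lambda>i j. i < 3 \<and> 3 \<le> j))"
    by (rule has_induced_subgraph_iff_induces[OF G,
          where h = "\<lambda>i. if i < 3 then Inl i else Inr (i - 3)"])
      (use bij_betw_split_sum[of 3 2] in \<open>auto simp: D4_def verts_named_graphs
        adjacent_complement adjacent_disjoint_union adjacent_complete_graph\<close>)
  show ?thesis
    unfolding obstruction_free_def obstruction.simps d1 d2 d3 d4 using cyc by blast
qed

section \<open>The class \<open>\<F>\<close> as the graphs with difunctional non-adjacency\<close>

definition difunctional :: "'a graph \<Rightarrow> 'a set \<Rightarrow> bool" where
  "difunctional G W \<longleftrightarrow> (\<forall>a\<in>W. \<forall>b\<in>W. \<forall>c\<in>W. \<forall>d\<in>W.
     nonadj G a b \<longrightarrow> nonadj G b c \<longrightarrow> nonadj G c d \<longrightarrow> nonadj G a d)"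

lemma difunctionalD:
  "difunctional G W \<Longrightarrow> nonadj G a b \<Longrightarrow> nonadj G b c \<Longrightarrow> nonadj G c d \<Longrightarrow>
    a \<in> W \<Longrightarrow> b \<in> W \<Longrightarrow> c \<in> W \<Longrightarrow> d \<in> W \<Longrightarrow> nonadj G a d"
  unfolding difunctional_def by blast

lemma difunctional_subset: "difunctional G W \<Longrightarrow> U \<subseteq> W \<Longrightarrow> difunctional G U"
  unfolding difunctional_def by (meson subsetD)

lemma disjoint_family_on_same_part:
  "disjoint_family_on P I \<Longrightarrow> p \<in> I \<Longrightarrow> q \<in> I \<Longrightarrow> u \<in> P p \<Longrightarrow> u \<in> P q \<Longrightarrow> p = q"
  by (metis IntI disjoint_family_onD empty_iff)

lemma X_part [simp]: "X j \<in> part_names k \<longleftrightarrow> j \<in> {1..k}"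
  and Y_part [simp]: "Y j \<in> part_names k \<longleftrightarrow> j \<in> {1..k}"
  and Z_part [simp]: "Z \<in> part_names k"
  by (auto simp: part_names_def)

definition opposite :: "(part \<Rightarrow> 'a set) \<Rightarrow> nat \<Rightarrow> 'a \<Rightarrow> 'a \<Rightarrow> bool" where
  "opposite P k u v \<longleftrightarrow>
     (\<exists>j\<in>{1..k}. u \<in> P (X j) \<and> v \<in> P (Y j) \<or> v \<in> P (X j) \<and> u \<in> P (Y j))"

text \<open>
  A step of the relation \<open>nonadj\<close> moves from \<open>X j\<close> to \<open>Y j\<close> or back with the same \<open>j\<close>, so three
  steps end in the part opposite to the starting one.
\<close>
lemma F_all_imp_difunctional:
  assumes "G \<in> F_all"
  shows "difunctional G (verts G)"
proof -
  obtain k P where cov: "(\<Union>p\<in>part_names k. P p) = verts G"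
    and dis: "disjoint_family_on P (part_names k)"
    and cl: "\<forall>p\<in>part_names k. clique G (P p)"
    and na: "\<forall>p\<in>part_names k. \<forall>q\<in>part_names k. p \<noteq> q \<longrightarrow> (\<forall>u\<in>P p. \<forall>v\<in>P q.
       \<not> adjacent G u v \<longleftrightarrow> opposite P k u v)"
  proof -
    from assms obtain k where "G \<in> F_class k" by (auto simp: F_all_def)
    then show ?thesis
      unfolding F_class_def opposite_def[symmetric] by (elim CollectE conjE exE) (rule that)
  qed
  have opp: "nonadj G u v \<longleftrightarrow> opposite P k u v" (is "_ = ?R") for u v
  proof
    assume n: "nonadj G u v"
    then obtain p q where pq: "p \<in> part_names k" "q \<in> part_names k" "u \<in> P p" "v \<in> P q"
      using cov nonadj_verts[OF n] by blast
    moreover have "p \<noteq> q" using cl pq n by (auto simp: clique_def nonadj_def)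
    ultimately show ?R using na n unfolding nonadj_def by blast
  next
    assume ?R
    then obtain p q where pq: "p \<in> part_names k" "q \<in> part_names k" "p \<noteq> q" "u \<in> P p" "v \<in> P q"
    proof -
      from \<open>?R\<close> obtain j where "j \<in> {1..k}"
        "u \<in> P (X j) \<and> v \<in> P (Y j) \<or> v \<in> P (X j) \<and> u \<in> P (Y j)"
        unfolding opposite_def by blast
      then show ?thesis using that[of "X j" "Y j"] that[of "Y j" "X j"] by auto
    qed
    then have "\<not> adjacent G u v" using na \<open>?R\<close> by blast
    moreover have "u \<noteq> v" using disjoint_family_on_same_part[OF dis] pq by blast
    moreover have "u \<in> verts G" "v \<in> verts G" using cov pq by blast+
    ultimately show "nonadj G u v" by (simp add: nonadj_def)
  qed
  have same: "p = q" if "u \<in> P p" "u \<in> P q" "p \<in> part_names k" "q \<in> part_names k" for u p q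
    using disjoint_family_on_same_part[OF dis] that by blast
  show ?thesis
    unfolding difunctional_def
  proof (intro ballI impI)
    fix a b c d
    assume ab: "nonadj G a b" and bc: "nonadj G b c" and cd: "nonadj G c d"
    obtain i where i: "i \<in> {1..k}" "a \<in> P (X i) \<and> b \<in> P (Y i) \<or> b \<in> P (X i) \<and> a \<in> P (Y i)"
      using ab opp unfolding opposite_def by blast
    obtain j where j: "j \<in> {1..k}" "b \<in> P (X j) \<and> c \<in> P (Y j) \<or> c \<in> P (X j) \<and> b \<in> P (Y j)"
      using bc opp unfolding opposite_def by blast
    obtain l where l: "l \<in> {1..k}" "c \<in> P (X l) \<and> d \<in> P (Y l) \<or> d \<in> P (X l) \<and> c \<in> P (Y l)"
      using cd opp unfolding opposite_def by blast
    have XX: "i' = j'" if "u \<in> P (X i')" "u \<in> P (X j')" "i' \<in> {1..k}" "j' \<in> {1..k}" for u i' j'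
      using same[of u "X i'" "X j'"] that by simp
    have YY: "i' = j'" if "u \<in> P (Y i')" "u \<in> P (Y j')" "i' \<in> {1..k}" "j' \<in> {1..k}" for u i' j'
      using same[of u "Y i'" "Y j'"] that by simp
    have XY: False if "u \<in> P (X i')" "u \<in> P (Y j')" "i' \<in> {1..k}" "j' \<in> {1..k}" for u i' j'
      using same[of u "X i'" "Y j'"] that by simp
    have "i = j" using XX[of b i j] YY[of b i j] XY[of b i j] XY[of b j i] i j by blast
    moreover have "j = l" using XX[of c j l] YY[of c j l] XY[of c j l] XY[of c l j] j l by blast
    ultimately show "nonadj G a d"
      using i j l XY[of b i i] XY[of c i i] unfolding opp opposite_def by blast
  qed
qed

lemma part_names_Suc:
  "part_names (Suc k) = insert (X (Suc k)) (insert (Y (Suc k)) (part_names k))"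
  by (auto simp: part_names_def atLeastAtMostSuc_conv)

text \<open>
  The pairs \<open>X j\<close>, \<open>Y j\<close> are split off one at a time. For non-adjacent \<open>a\<close>, \<open>b\<close> the sets \<open>A\<close> of
  vertices non-adjacent to \<open>b\<close> and \<open>B\<close> of vertices non-adjacent to \<open>a\<close> are disjoint and completely
  non-adjacent to each other, and no other vertex is non-adjacent to a member of either: they are the
  two sides of one component of the complement.
\<close>
lemma difunctional_partition:
  assumes "finite W" "W \<subseteq> verts G" "difunctional G W"
  shows "\<exists>k P. (\<Union>p\<in>part_names k. P p) = W \<and> disjoint_family_on P (part_names k) \<and>
    (\<forall>j\<in>{1..k}. P (X j) \<noteq> {} \<and> P (Y j) \<noteq> {}) \<and>
    (\<forall>u\<in>W. \<forall>v\<in>W. nonadj G u v \<longleftrightarrow> opposite P k u v)"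
  using assms
proof (induction W rule: finite_psubset_induct)
  case (psubset W)
  show ?case
  proof (cases "\<exists>u\<in>W. \<exists>v\<in>W. nonadj G u v")
    case False
    have "part_names 0 = {Z}" by (simp add: part_names_def)
    then show ?thesis
      using False by (intro exI[of _ "0::nat"] exI[of _ "\<lambda>_. W"])
        (simp add: disjoint_family_on_def opposite_def)
  next
    case True
    then obtain a b where ab: "a \<in> W" "b \<in> W" "nonadj G a b" by blast
    note di = difunctionalD[OF psubset.prems(2)]
    define A where "A = {u\<in>W. nonadj G u b}"
    define B where "B = {v\<in>W. nonadj G v a}"
    define U where "U = W - A - B"
    have aA: "a \<in> A" and bB: "b \<in> B"
      using ab by (auto simp: A_def B_def nonadj_commute)
    have disj: "A \<inter> B = {}"
    proof -
      have False if "u \<in> W" "nonadj G u b" "nonadj G u a" for u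
        using di[of a b u a] that ab nonadj_commute[of G u b] by auto
      then show ?thesis by (auto simp: A_def B_def)
    qed
    have AB: "nonadj G u v" if "u \<in> A" "v \<in> B" for u v
      using di[of u b a v] that ab nonadj_commute[of G] by (auto simp: A_def B_def)
    have AtoB: "y \<in> B" if "x \<in> A" "y \<in> W" "nonadj G x y" for x y
      using di[of a b x y] that ab nonadj_commute[of G] by (auto simp: A_def B_def)
    have BtoA: "y \<in> A" if "x \<in> B" "y \<in> W" "nonadj G x y" for x y
      using di[of b a x y] that ab nonadj_commute[of G] by (auto simp: A_def B_def)
    have U: "U \<subset> W" using aA ab by (auto simp: U_def)
    then have "U \<subseteq> verts G" "difunctional G U"
      using psubset.prems difunctional_subset[of G W U] by auto
    then obtain k P where
      cov: "(\<Union>p\<in>part_names k. P p) = U" and dis: "disjoint_family_on P (part_names k)"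
      and ne: "\<forall>j\<in>{1..k}. P (X j) \<noteq> {} \<and> P (Y j) \<noteq> {}"
      and na: "\<forall>u\<in>U. \<forall>v\<in>U. nonadj G u v \<longleftrightarrow> opposite P k u v"
      using psubset.IH[OF U] by blast
    define Q where "Q = P(X (Suc k) := A, Y (Suc k) := B)"
    have Q: "Q (X (Suc k)) = A" "Q (Y (Suc k)) = B"
      "\<And>j. j \<in> {1..k} \<Longrightarrow> Q (X j) = P (X j)" "\<And>j. j \<in> {1..k} \<Longrightarrow> Q (Y j) = P (Y j)"
      "\<And>p. p \<in> part_names k \<Longrightarrow> Q p = P p"
      by (auto simp: Q_def)
    have subU: "P p \<subseteq> U" if "p \<in> part_names k" for p using cov that by blast
    have "(\<Union>p\<in>part_names (Suc k). Q p) = A \<union> B \<union> (\<Union>p\<in>part_names k. Q p)"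
      by (auto simp: part_names_Suc Q)
    also have "(\<Union>p\<in>part_names k. Q p) = U" using cov Q(5) by simp
    also have "A \<union> B \<union> U = W" by (auto simp: U_def A_def B_def)
    finally have covQ: "(\<Union>p\<in>part_names (Suc k). Q p) = W" .
    have "disjoint_family_on Q (part_names k)"
      using dis Q(5) by (simp add: disjoint_family_on_def)
    moreover have "A \<inter> Q p = {}" "B \<inter> Q p = {}" if "p \<in> part_names k" for p
      using subU[OF that] Q(5)[OF that] by (auto simp: U_def)
    ultimately have disQ: "disjoint_family_on Q (part_names (Suc k))"
      using disj unfolding part_names_Suc
      by (subst disjoint_family_on_insert; auto simp: Q disjoint_family_on_insert)
    have neQ: "\<forall>j\<in>{1..Suc k}. Q (X j) \<noteq> {} \<and> Q (Y j) \<noteq> {}"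
      using ne aA bB Q by (auto simp: atLeastAtMostSuc_conv)
    have ex: "opposite Q (Suc k) u v \<longleftrightarrow>
       (u \<in> A \<and> v \<in> B \<or> v \<in> A \<and> u \<in> B) \<or> opposite P k u v" for u v
      using Q by (auto simp: opposite_def atLeastAtMostSuc_conv)
    have "nonadj G u v \<longleftrightarrow> (u \<in> A \<and> v \<in> B \<or> v \<in> A \<and> u \<in> B) \<or> opposite P k u v"
      if "u \<in> W" "v \<in> W" for u v
    proof (cases "u \<in> U \<and> v \<in> U")
      case True
      then show ?thesis using na by (auto simp: U_def)
    next
      case False
      have "\<not> opposite P k u v"
      proof -
        have "P (X j) \<subseteq> U" "P (Y j) \<subseteq> U" if "j \<in> {1..k}" for j
          using subU that by auto
        then show ?thesis using False unfolding opposite_def by blast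
      qed
      moreover have "u \<in> A \<or> u \<in> B \<or> v \<in> A \<or> v \<in> B"
        using False that by (auto simp: U_def)
      ultimately show ?thesis
        using AB[of u v] AB[of v u] AtoB[of u v] AtoB[of v u] BtoA[of u v] BtoA[of v u]
          that nonadj_commute[of G u v] by blast
    qed
    then have naQ: "\<forall>u\<in>W. \<forall>v\<in>W. nonadj G u v \<longleftrightarrow> opposite Q (Suc k) u v"
      unfolding ex by simp
    show ?thesis
      by (intro exI[of _ "Suc k"] exI[of _ Q] conjI covQ disQ neQ naQ)
  qed
qed

lemma F_all_iff_difunctional:
  assumes "finite_simple_graph G"
  shows "G \<in> F_all \<longleftrightarrow> difunctional G (verts G)"
proof
  assume "difunctional G (verts G)"
  moreover have "finite (verts G)" using assms by (simp add: finite_simple_graph_def)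
  ultimately obtain k P where cov: "(\<Union>p\<in>part_names k. P p) = verts G"
    and dis: "disjoint_family_on P (part_names k)"
    and ne: "\<forall>j\<in>{1..k}. P (X j) \<noteq> {} \<and> P (Y j) \<noteq> {}"
    and na: "\<forall>u\<in>verts G. \<forall>v\<in>verts G. nonadj G u v \<longleftrightarrow> opposite P k u v"
    using difunctional_partition[of "verts G" G] by blast
  note same = disjoint_family_on_same_part[OF dis]
  have sub: "P p \<subseteq> verts G" if "p \<in> part_names k" for p using cov that by blast
  have clq: "clique G (P p)" if p: "p \<in> part_names k" for p
    unfolding clique_def
  proof (intro conjI ballI impI)
    show "P p \<subseteq> verts G" by (rule sub[OF p])
    fix u v assume uv: "u \<in> P p" "v \<in> P p" "u \<noteq> v"
    have "\<not> (u \<in> P (X j) \<and> v \<in> P (Y j))" "\<not> (v \<in> P (X j) \<and> u \<in> P (Y j))" if "j \<in> {1..k}" for j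
      using same[of p "X j"] same[of p "Y j"] uv p that by auto
    then have "\<not> nonadj G u v" using na sub[OF p] uv unfolding opposite_def by blast
    then show "adjacent G u v" using uv sub[OF p] by (auto simp: nonadj_def)
  qed
  have "\<not> adjacent G u v \<longleftrightarrow> nonadj G u v"
    if "p \<in> part_names k" "q \<in> part_names k" "p \<noteq> q" "u \<in> P p" "v \<in> P q" for p q u v
  proof -
    have "u \<noteq> v" using same that by blast
    then show ?thesis using sub that by (auto simp: nonadj_def)
  qed
  then have na': "\<forall>p\<in>part_names k. \<forall>q\<in>part_names k. p \<noteq> q \<longrightarrow> (\<forall>u\<in>P p. \<forall>v\<in>P q.
      \<not> adjacent G u v \<longleftrightarrow> opposite P k u v)"
    using na sub by (meson subsetD)
  have "G \<in> F_class k"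
    unfolding F_class_def opposite_def[symmetric] mem_Collect_eq
    by (intro conjI exI[of _ P] assms cov dis ne na') (use clq in blast)
  then show "G \<in> F_all" by (auto simp: F_all_def)
qed (rule F_all_imp_difunctional)

section \<open>Clique-sums contain no forbidden graph\<close>

text \<open>
  Each pattern has four positions violating the difunctional law: \<open>0, 2, 4, 1\<close> on a cycle, the first
  four positions (an induced \<open>P\<^sub>4\<close> of the complement) in three of the others, and the triangle
  \<open>0, 1, 2, 0\<close> of the complement in the last.
\<close>
lemma F_all_obstruction_free:
  assumes "G \<in> F_all"
  shows "obstruction_free G"
  unfolding obstruction_free_def
proof (intro allI impI notI)
  fix xs R assume o: "obstruction (length xs) R" and ind: "induces G xs R"
  note di = difunctionalD[OF F_all_imp_difunctional[OF assms]]
  have N: "nonadj G (xs ! i) (xs ! j) \<longleftrightarrow> \<not> R i j" if "i < j" "j < length xs" for i j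
    using ind that by (auto simp: induces_def nonadj_def nth_eq_iff_index_eq)
  have V: "xs ! i \<in> verts G" if "i < length xs" for i
    using ind that by (auto simp: induces_def)
  show False
    using o
  proof cases
    case cycle
    then have "xs \<noteq> []" by auto
    with cycle show False
      using di[of "xs ! 0" "xs ! 2" "xs ! 4" "xs ! 1"] N[of 0 2] N[of 2 4] N[of 1 4] N[of 0 1]
        V[of 0] V[of 1] V[of 2] V[of 4] \<open>xs \<noteq> []\<close>
        nonadj_commute[of G "xs ! 4" "xs ! 1"] by (auto simp: cycle_pattern_def)
  next
    case co_K3_K2
    then show False
      using di[of "xs ! 0" "xs ! 1" "xs ! 2" "xs ! 0"] N[of 0 1] N[of 1 2] N[of 0 2] V
        nonadj_commute[of G "xs ! 2" "xs ! 0"] by auto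
  qed (use di[of "xs ! 0" "xs ! 1" "xs ! 2" "xs ! 3"] N[of 0 1] N[of 1 2] N[of 2 3] N[of 0 3] V
      in \<open>auto simp: cycle_pattern_def\<close>)
qed

text \<open>
  A clique cutset is encoded by the two sides \<open>A\<close> and \<open>B\<close> that it separates; the cutset itself is
  the set of the remaining positions.
\<close>
definition clique_cutset_free :: "nat \<Rightarrow> (nat \<Rightarrow> nat \<Rightarrow> bool) \<Rightarrow> bool" where
  "clique_cutset_free n R \<longleftrightarrow> (\<forall>A B.
     A \<inter> B = {} \<and> A \<union> B \<subseteq> {..<n} \<and>
     (\<forall>i<n. \<forall>j<n. i < j \<longrightarrow> i \<in> A \<and> j \<in> B \<or> i \<in> B \<and> j \<in> A \<longrightarrow> \<not> R i j) \<and>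
     (\<forall>i<n. \<forall>j<n. i < j \<longrightarrow> i \<notin> A \<union> B \<longrightarrow> j \<notin> A \<union> B \<longrightarrow> R i j) \<longrightarrow>
     A = {} \<or> B = {})"

text \<open>
  The two arcs between a position of \<open>A\<close> and a position of \<open>B\<close> must both meet the cutset, and
  inner positions of different arcs are never adjacent.
\<close>
lemma cycle_pattern_clique_cutset_free:
  assumes "n \<ge> 4"
  shows "clique_cutset_free n (cycle_pattern n)"
proof -
  have main: False
    if disj: "A \<inter> B = {}" and sub: "A \<union> B \<subseteq> {..<n}"
      and nadj: "\<And>i j. i < j \<Longrightarrow> j < n \<Longrightarrow> i \<in> A \<and> j \<in> B \<or> i \<in> B \<and> j \<in> A \<Longrightarrow> \<not> cycle_pattern n i j"
      and cut: "\<And>i j. i < j \<Longrightarrow> j < n \<Longrightarrow> i \<notin> A \<union> B \<Longrightarrow> j \<notin> A \<union> B \<Longrightarrow> cycle_pattern n i j"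
      and ab: "a \<in> A" "b \<in> B" "a < b" for A B a b
  proof -
    have b: "b < n" using ab sub by auto
    have suc: "Suc i \<in> A" if "i \<in> A" "Suc i \<in> A \<union> B" for i
      using nadj[of i "Suc i"] that sub by (auto simp: cycle_pattern_def)
    \<comment> \<open>If the arc from \<open>a\<close> up to \<open>b\<close> missed the cutset, membership in \<open>A\<close> would spread along it.\<close>
    have "\<exists>s. a < s \<and> s < b \<and> s \<notin> A \<union> B"
    proof (rule ccontr)
      assume *: "\<nexists>s. a < s \<and> s < b \<and> s \<notin> A \<union> B"
      have "i \<le> b \<Longrightarrow> i \<in> A" if "a \<le> i" for i
        using that
      proof (induction i rule: dec_induct)
        case (step i)
        then have "Suc i \<in> A \<union> B" using * ab by (cases "Suc i = b") auto
        then show ?case using suc[of i] step by simp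
      qed (use ab in simp)
      then have "b \<in> A" using ab by simp
      then show False using ab disj by blast
    qed
    then obtain s where s: "a < s" "s < b" "s \<notin> A \<union> B" by blast
    \<comment> \<open>The other arc passes through the pair \<open>n - 1\<close>, \<open>0\<close>, which closes the cycle.\<close>
    have "\<exists>t. (t < a \<or> b < t) \<and> t < n \<and> t \<notin> A \<union> B"
    proof (rule ccontr)
      assume "\<nexists>t. (t < a \<or> b < t) \<and> t < n \<and> t \<notin> A \<union> B"
      then have *: "t \<in> A \<union> B" if "t < a \<or> b < t" "t < n" for t using that by blast
      have up: "i < n \<Longrightarrow> i \<in> B" if "b \<le> i" for i
        using that
      proof (induction i rule: dec_induct)
        case (step i)
        then have "Suc i \<in> A \<union> B" using * by auto
        then show ?case
          using nadj[of i "Suc i"] step disj by (auto simp: cycle_pattern_def)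
      qed (use ab in simp)
      have down: "i \<in> A" if "i \<le> a" for i
        using that
      proof (induction i rule: inc_induct)
        case (step i)
        then have "i \<in> A \<union> B" using *[of i] b ab by simp
        then show ?case
          using nadj[of i "Suc i"] step disj b ab by (auto simp: cycle_pattern_def)
      qed (use ab in simp)
      have "n - 1 \<in> B" using up[of "n - 1"] b by simp
      moreover have "0 \<in> A" using down by simp
      ultimately show False
        using nadj[of 0 "n - 1"] b ab by (auto simp: cycle_pattern_def)
    qed
    then obtain t where t: "t < a \<or> b < t" "t < n" "t \<notin> A \<union> B" by blast
    then show False
      using cut[of s t] cut[of t s] s b ab by (auto simp: cycle_pattern_def)
  qed
  show ?thesis
    unfolding clique_cutset_free_def
  proof (intro allI impI)
    fix A B
    assume H: "A \<inter> B = {} \<and> A \<union> B \<subseteq> {..<n} \<and>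
     (\<forall>i<n. \<forall>j<n. i < j \<longrightarrow> i \<in> A \<and> j \<in> B \<or> i \<in> B \<and> j \<in> A \<longrightarrow> \<not> cycle_pattern n i j) \<and>
     (\<forall>i<n. \<forall>j<n. i < j \<longrightarrow> i \<notin> A \<union> B \<longrightarrow> j \<notin> A \<union> B \<longrightarrow> cycle_pattern n i j)"
    have disj: "A \<inter> B = {}" "B \<inter> A = {}" and sub: "A \<union> B \<subseteq> {..<n}" "B \<union> A \<subseteq> {..<n}"
      using H by blast+
    have nadj: "\<not> cycle_pattern n i j"
      if "i < j" "j < n" "i \<in> A \<and> j \<in> B \<or> i \<in> B \<and> j \<in> A" for i j
      using H that less_trans[of i j n] by blast
    have cut: "cycle_pattern n i j"
      if "i < j" "j < n" "i \<notin> A \<union> B" "j \<notin> A \<union> B" for i j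
      using H that less_trans[of i j n] by blast
    show "A = {} \<or> B = {}"
    proof (rule ccontr)
      assume "\<not> (A = {} \<or> B = {})"
      then obtain a b where ab: "a \<in> A" "b \<in> B" by blast
      then consider "a < b" | "b < a" using disj by (metis IntI empty_iff linorder_neqE_nat)
      then show False
      proof cases
        case 1
        show False by (rule main[OF disj(1) sub(1) nadj cut ab 1])
      next
        case 2
        show False by (rule main[OF disj(2) sub(2) nadj cut ab(2,1) 2]) blast+
      qed
    qed
  qed
qed

text \<open>
  For a fixed numeral \<open>n\<close> all quantifiers of this rule range over bounded numbers, which turns the
  condition into a propositional problem.
\<close>
lemma clique_cutset_freeI:
  assumes "\<And>A B. A \<inter> B = {} \<Longrightarrow>
     \<forall>j<n. \<forall>i<j. i \<in> A \<and> j \<in> B \<or> i \<in> B \<and> j \<in> A \<longrightarrow> \<not> R i j \<Longrightarrow>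
     \<forall>j<n. \<forall>i<j. i \<notin> A \<union> B \<longrightarrow> j \<notin> A \<union> B \<longrightarrow> R i j \<Longrightarrow>
     (\<forall>i<n. i \<notin> A) \<or> (\<forall>i<n. i \<notin> B)"
  shows "clique_cutset_free n R"
  unfolding clique_cutset_free_def
proof (intro allI impI)
  fix A B
  assume H: "A \<inter> B = {} \<and> A \<union> B \<subseteq> {..<n} \<and>
     (\<forall>i<n. \<forall>j<n. i < j \<longrightarrow> i \<in> A \<and> j \<in> B \<or> i \<in> B \<and> j \<in> A \<longrightarrow> \<not> R i j) \<and>
     (\<forall>i<n. \<forall>j<n. i < j \<longrightarrow> i \<notin> A \<union> B \<longrightarrow> j \<notin> A \<union> B \<longrightarrow> R i j)"
  have "(\<forall>i<n. i \<notin> A) \<or> (\<forall>i<n. i \<notin> B)"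
    by (rule assms) (use H in auto)
  then show "A = {} \<or> B = {}" using H by auto
qed

lemma obstruction_clique_cutset_free:
  assumes "obstruction n R"
  shows "clique_cutset_free n R"
  using assms
proof cases
  case cycle
  then show ?thesis by (simp add: cycle_pattern_clique_cutset_free)
next
  case co_P6
  show ?thesis
    unfolding co_P6
    by (rule clique_cutset_freeI, simp add: numeral_eq_Suc All_less_Suc disjoint_iff, smt (verit))
next
  case co_C6
  show ?thesis
    unfolding co_C6
    by (rule clique_cutset_freeI, simp add: numeral_eq_Suc All_less_Suc disjoint_iff cycle_pattern_def, argo)
next
  case co_P4_K2
  show ?thesis
    unfolding co_P4_K2
    by (rule clique_cutset_freeI, simp add: numeral_eq_Suc All_less_Suc disjoint_iff, metis)
next
  case co_K3_K2
  show ?thesis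
    unfolding co_K3_K2
    by (rule clique_cutset_freeI, simp add: numeral_eq_Suc All_less_Suc disjoint_iff, blast)
qed

text \<open>
  A clique-sum decomposition seen from inside the sum: \<open>U\<close> and \<open>V\<close> are the places of the two
  summands.
\<close>
definition separation :: "'a graph \<Rightarrow> 'a set \<Rightarrow> 'a set \<Rightarrow> bool" where
  "separation G U V \<longleftrightarrow> verts G = U \<union> V \<and> clique G (U \<inter> V) \<and>
     (\<forall>u\<in>U - V. \<forall>v\<in>V - U. \<not> adjacent G u v)"

text \<open>
  Gluing adds no edge inside a summand: such an edge would have to come from the other summand,
  hence join two vertices of the common clique, where it is present already.
\<close>
lemma clique_sum_separation:
  assumes sum: "is_clique_sum G\<^sub>1 G\<^sub>2 G"
    and simple: "finite_simple_graph G\<^sub>1" "finite_simple_graph G\<^sub>2"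
  obtains f\<^sub>1 f\<^sub>2 where "separation G (f\<^sub>1 ` verts G\<^sub>1) (f\<^sub>2 ` verts G\<^sub>2)"
    "inj_on f\<^sub>1 (verts G\<^sub>1)" "inj_on f\<^sub>2 (verts G\<^sub>2)"
    "\<And>a b. a \<in> verts G\<^sub>1 \<Longrightarrow> b \<in> verts G\<^sub>1 \<Longrightarrow> adjacent G (f\<^sub>1 a) (f\<^sub>1 b) \<longleftrightarrow> adjacent G\<^sub>1 a b"
    "\<And>a b. a \<in> verts G\<^sub>2 \<Longrightarrow> b \<in> verts G\<^sub>2 \<Longrightarrow> adjacent G (f\<^sub>2 a) (f\<^sub>2 b) \<longleftrightarrow> adjacent G\<^sub>2 a b"
    "finite_simple_graph G"
proof -
  from sum obtain K\<^sub>1 K\<^sub>2 f\<^sub>1 f\<^sub>2 where K: "clique G\<^sub>1 K\<^sub>1" "clique G\<^sub>2 K\<^sub>2"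
    and inj: "inj_on f\<^sub>1 (verts G\<^sub>1)" "inj_on f\<^sub>2 (verts G\<^sub>2)" and fK: "f\<^sub>1 ` K\<^sub>1 = f\<^sub>2 ` K\<^sub>2"
    and int: "f\<^sub>1 ` verts G\<^sub>1 \<inter> f\<^sub>2 ` verts G\<^sub>2 = f\<^sub>1 ` K\<^sub>1"
    and G: "G = graph_union (graph_image f\<^sub>1 G\<^sub>1) (graph_image f\<^sub>2 G\<^sub>2)"
    unfolding is_clique_sum_def by blast
  have verts: "verts G = f\<^sub>1 ` verts G\<^sub>1 \<union> f\<^sub>2 ` verts G\<^sub>2"
    and edges: "edges G = (`) f\<^sub>1 ` edges G\<^sub>1 \<union> (`) f\<^sub>2 ` edges G\<^sub>2"
    by (simp_all add: G graph_union_def graph_image_def)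
  have edge: "e \<subseteq> verts H \<and> card e = 2" if "finite_simple_graph H" "e \<in> edges H" for H :: "'x graph" and e
    using that by (simp add: finite_simple_graph_def)
  have image_edge: "f ` e \<subseteq> f ` verts H \<and> card (f ` e) = 2"
    if "finite_simple_graph H" "e \<in> edges H" "inj_on f (verts H)" for H :: "'x graph" and f :: "'x \<Rightarrow> 'z" and e
    using edge[OF that(1,2)] that(3) by (metis card_image image_mono inj_on_subset)
  have fin: "finite_simple_graph G"
    using simple image_edge[OF simple(1) _ inj(1)] image_edge[OF simple(2) _ inj(2)]
    unfolding finite_simple_graph_def verts edges by blast
  \<comment> \<open>Stated for arbitrary summands, so that it can be used with the two of them in either order.\<close>
  have one: "adjacent G (f a) (f b) \<longleftrightarrow> adjacent H a b"
    if ab: "a \<in> verts H" "b \<in> verts H" and H: "finite_simple_graph H" "finite_simple_graph H'"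
      and f: "inj_on f (verts H)" and f': "inj_on f' (verts H')"
      and K: "clique H K" and int: "f ` verts H \<inter> f' ` verts H' = f ` K"
      and edges: "edges G = (`) f ` edges H \<union> (`) f' ` edges H'"
    for H :: "'x graph" and H' :: "'y graph" and f f' K a b
  proof
    assume "adjacent G (f a) (f b)"
    then consider e where "e \<in> edges H" "f ` e = {f a, f b}"
      | e where "e \<in> edges H'" "f' ` e = {f a, f b}"
      by (auto simp: adjacent_def edges)
    then show "adjacent H a b"
    proof cases
      case 1
      have "f ` e = f ` {a, b}" using 1 by simp
      then have "e = {a, b}"
        using inj_on_image_eq_iff[OF f, of e "{a, b}"] edge[OF H(1) 1(1)] ab by simp
      then show ?thesis using 1 by (simp add: adjacent_def)
    next
      case 2
      have "card {f a, f b} = 2" "{f a, f b} \<subseteq> f' ` verts H'"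
        using image_edge[OF H(2) 2(1) f'] 2(2) by simp_all
      then have "f a \<noteq> f b" "f a \<in> f ` K" "f b \<in> f ` K"
        using ab int by auto
      moreover have "K \<subseteq> verts H" using K by (simp add: clique_def)
      ultimately have "a \<noteq> b" "a \<in> K" "b \<in> K"
        using ab f by (auto dest: inj_onD)
      then show ?thesis using K by (simp add: clique_def)
    qed
  next
    assume "adjacent H a b"
    then have "f ` {a, b} \<in> edges G"
      unfolding adjacent_def edges by (intro UnI1 imageI)
    then show "adjacent G (f a) (f b)" by (simp add: adjacent_def)
  qed
  have adj1: "adjacent G (f\<^sub>1 a) (f\<^sub>1 b) \<longleftrightarrow> adjacent G\<^sub>1 a b" if "a \<in> verts G\<^sub>1" "b \<in> verts G\<^sub>1" for a b
    using one[OF that simple inj K(1) int edges] .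
  have adj2: "adjacent G (f\<^sub>2 a) (f\<^sub>2 b) \<longleftrightarrow> adjacent G\<^sub>2 a b" if "a \<in> verts G\<^sub>2" "b \<in> verts G\<^sub>2" for a b
    using that simple(2,1) inj(2,1) K(2)
  proof (rule one)
    show "f\<^sub>2 ` verts G\<^sub>2 \<inter> f\<^sub>1 ` verts G\<^sub>1 = f\<^sub>2 ` K\<^sub>2" using int fK by (simp only: Int_commute)
    show "edges G = (`) f\<^sub>2 ` edges G\<^sub>2 \<union> (`) f\<^sub>1 ` edges G\<^sub>1" using edges by (simp only: Un_commute)
  qed
  have "clique G (f\<^sub>1 ` K\<^sub>1)"
    using K(1) adj1 verts by (auto simp: clique_def subset_iff)
  moreover have "\<not> adjacent G u v"
    if "u \<in> f\<^sub>1 ` verts G\<^sub>1 - f\<^sub>2 ` verts G\<^sub>2" "v \<in> f\<^sub>2 ` verts G\<^sub>2 - f\<^sub>1 ` verts G\<^sub>1" for u v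
  proof
    assume "adjacent G u v"
    then consider e where "e \<in> edges G\<^sub>1" "f\<^sub>1 ` e = {u, v}" | e where "e \<in> edges G\<^sub>2" "f\<^sub>2 ` e = {u, v}"
      by (auto simp: adjacent_def edges)
    then show False
      using image_edge[OF simple(1) _ inj(1)] image_edge[OF simple(2) _ inj(2)] that by cases force+
  qed
  ultimately have "separation G (f\<^sub>1 ` verts G\<^sub>1) (f\<^sub>2 ` verts G\<^sub>2)"
    unfolding separation_def verts int by blast
  then show thesis by (rule that[OF _ inj adj1 adj2 fin])
qed

lemma induces_one_side:
  assumes sep: "separation G U V" and ind: "induces G xs R"
    and R: "clique_cutset_free (length xs) R"
  shows "set xs \<subseteq> U \<or> set xs \<subseteq> V"
proof -
  define A where "A = {i. i < length xs \<and> xs ! i \<in> U - V}"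
  define B where "B = {i. i < length xs \<and> xs ! i \<in> V - U}"
  have mem: "xs ! i \<in> U \<union> V" if "i < length xs" for i
    using ind sep nth_mem[OF that] by (auto simp: induces_def separation_def)
  have adj: "adjacent G (xs ! i) (xs ! j) \<longleftrightarrow> R i j" if "i < j" "j < length xs" for i j
    using ind that by (simp add: induces_def)
  have "\<not> R i j" if "i < j" "j < length xs" "i \<in> A \<and> j \<in> B \<or> i \<in> B \<and> j \<in> A" for i j
    using that sep adj[of i j] adjacent_commute[of G]
    unfolding separation_def A_def B_def by blast
  moreover have "R i j" if "i < j" "j < length xs" "i \<notin> A \<union> B" "j \<notin> A \<union> B" for i j
  proof -
    have "xs ! i \<in> U \<inter> V" "xs ! j \<in> U \<inter> V"
      using that mem[of i] mem[of j] by (auto simp: A_def B_def)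
    moreover have "xs ! i \<noteq> xs ! j"
      using ind that by (simp add: induces_def nth_eq_iff_index_eq)
    ultimately show ?thesis
      using sep adj[of i j] that by (auto simp: separation_def clique_def)
  qed
  moreover have "A \<inter> B = {}" "A \<union> B \<subseteq> {..<length xs}" by (auto simp: A_def B_def)
  ultimately have "A = {} \<or> B = {}"
    using R[unfolded clique_cutset_free_def, rule_format, of A B] by simp
  moreover have "set xs \<subseteq> V" if "A = {}"
    using that mem by (fastforce simp: A_def in_set_conv_nth)
  moreover have "set xs \<subseteq> U" if "B = {}"
    using that mem by (fastforce simp: B_def in_set_conv_nth)
  ultimately show ?thesis by blast
qed

lemma induces_pullback:
  assumes f: "inj_on f (verts H)" and sub: "set xs \<subseteq> f ` verts H"
    and adj: "\<And>a b. a \<in> verts H \<Longrightarrow> b \<in> verts H \<Longrightarrow> adjacent G (f a) (f b) \<longleftrightarrow> adjacent H a b"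
    and ind: "induces G xs R"
  obtains ys where "length ys = length xs" "induces H ys R"
proof -
  define ys where "ys = map (inv_into (verts H) f) xs"
  have ys: "set ys \<subseteq> verts H" "xs = map f ys"
    using sub by (auto simp: ys_def inv_into_into f_inv_into_f subset_iff map_idI intro!: map_idI[symmetric])
  have "distinct ys" using ind ys by (simp add: induces_def distinct_map)
  moreover have "adjacent H (ys ! i) (ys ! j) \<longleftrightarrow> R i j" if "j < length ys" "i < j" for i j
  proof -
    have "ys ! i \<in> verts H" "ys ! j \<in> verts H"
      using ys(1) that nth_mem[of i ys] nth_mem[of j ys] by auto
    then show ?thesis
      using adj[of "ys ! i" "ys ! j"] ind ys(2) that by (simp add: induces_def)
  qed
  ultimately show thesis using that[of ys] ys by (simp add: induces_def)
qed

lemma clique_sum_obstruction_free: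
  assumes "is_clique_sum G\<^sub>1 G\<^sub>2 G"
    and simple: "finite_simple_graph G\<^sub>1" "finite_simple_graph G\<^sub>2"
    and free: "obstruction_free G\<^sub>1" "obstruction_free G\<^sub>2"
  shows "finite_simple_graph G \<and> obstruction_free G"
proof -
  obtain f\<^sub>1 f\<^sub>2 where sep: "separation G (f\<^sub>1 ` verts G\<^sub>1) (f\<^sub>2 ` verts G\<^sub>2)"
    and inj: "inj_on f\<^sub>1 (verts G\<^sub>1)" "inj_on f\<^sub>2 (verts G\<^sub>2)"
    and adj1: "\<And>a b. a \<in> verts G\<^sub>1 \<Longrightarrow> b \<in> verts G\<^sub>1 \<Longrightarrow> adjacent G (f\<^sub>1 a) (f\<^sub>1 b) \<longleftrightarrow> adjacent G\<^sub>1 a b"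
    and adj2: "\<And>a b. a \<in> verts G\<^sub>2 \<Longrightarrow> b \<in> verts G\<^sub>2 \<Longrightarrow> adjacent G (f\<^sub>2 a) (f\<^sub>2 b) \<longleftrightarrow> adjacent G\<^sub>2 a b"
    and fin: "finite_simple_graph G"
    by (rule clique_sum_separation[OF assms(1-3)]) (rule that)
  have "\<not> induces G xs R" if o: "obstruction (length xs) R" for xs R
  proof
    assume ind: "induces G xs R"
    from induces_one_side[OF sep ind obstruction_clique_cutset_free[OF o]] show False
    proof
      assume "set xs \<subseteq> f\<^sub>1 ` verts G\<^sub>1"
      then show False
        using induces_pullback[OF inj(1) _ adj1 ind] free(1) o unfolding obstruction_free_def by metis
    next
      assume "set xs \<subseteq> f\<^sub>2 ` verts G\<^sub>2"
      then show False
        using induces_pullback[OF inj(2) _ adj2 ind] free(2) o unfolding obstruction_free_def by metis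
    qed
  qed
  then show ?thesis using fin by (simp add: obstruction_free_def)
qed

lemma F_all_finite_simple: "G \<in> F_all \<Longrightarrow> finite_simple_graph G"
  by (auto simp: F_all_def F_class_def)

lemma clique_sums_F_all_obstruction_free:
  assumes "G \<in> clique_sums F_all"
  shows "finite_simple_graph G \<and> obstruction_free G"
  using assms
proof induction
  case (single G)
  then show ?case using F_all_finite_simple F_all_obstruction_free by blast
next
  case (glue G\<^sub>1 G\<^sub>2 G)
  then show ?case using clique_sum_obstruction_free by blast
qed

section \<open>Forbidden graphs described by non-adjacent pairs\<close>

lemma induces_Nil [simp]: "induces G [] R"
  by (simp add: induces_def)

lemma induces_Cons:
  "induces G (z # qs) R \<longleftrightarrow> z \<in> verts G \<and> z \<notin> set qs \<and>
     (\<forall>j<length qs. adjacent G z (qs ! j) \<longleftrightarrow> R 0 (Suc j)) \<and>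
     induces G qs (\<lambda>i j. R (Suc i) (Suc j))"
proof -
  have "(\<forall>j<length (z # qs). \<forall>i<j. adjacent G ((z # qs) ! i) ((z # qs) ! j) \<longleftrightarrow> R i j) \<longleftrightarrow>
     (\<forall>j<length qs. adjacent G z (qs ! j) \<longleftrightarrow> R 0 (Suc j)) \<and>
     (\<forall>j<length qs. \<forall>i<j. adjacent G (qs ! i) (qs ! j) \<longleftrightarrow> R (Suc i) (Suc j))"
    by (simp only: list.size All_less_Suc2 nth_Cons_0 nth_Cons_Suc add_0_right add_Suc_right) auto
  then show ?thesis by (auto simp: induces_def)
qed

lemma induces_snoc:
  "induces G (qs @ [z]) R \<longleftrightarrow> z \<in> verts G \<and> z \<notin> set qs \<and>
     (\<forall>i<length qs. adjacent G (qs ! i) z \<longleftrightarrow> R i (length qs)) \<and> induces G qs R"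
  by (auto simp: induces_def nth_append All_less_Suc)

lemma obstruction_freeD:
  "obstruction_free G \<Longrightarrow> obstruction n R \<Longrightarrow> length xs = n \<Longrightarrow> \<not> induces G xs R"
  unfolding obstruction_free_def by blast

text \<open>
  The next four lemmas list the edges and the non-edges of the complement of a forbidden graph.
  The vertices are distinct because in each of these complements any two vertices are joined by an
  edge or told apart by an edge to a third vertex.
\<close>
lemma no_co_P6:
  assumes "obstruction_free G"
    and "nonadj G a b" "nonadj G b c" "nonadj G c d" "nonadj G d e" "nonadj G e f"
    and "\<not> nonadj G a c" "\<not> nonadj G a d" "\<not> nonadj G a e" "\<not> nonadj G a f"
      "\<not> nonadj G b d" "\<not> nonadj G b e" "\<not> nonadj G b f"
      "\<not> nonadj G c e" "\<not> nonadj G c f" "\<not> nonadj G d f"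
  shows False
proof -
  have "distinct [a, b, c, d, e, f]"
    using assms(2-) by (auto simp: nonadj_commute)
  moreover have "{a, b, c, d, e, f} \<subseteq> verts G"
    using assms(2-) by (auto dest: nonadj_verts)
  ultimately have "induces G [a, b, c, d, e, f] (\<lambda>i j. j \<noteq> Suc i)"
    using assms(2-) by (simp add: induces_Cons All_less_Suc nonadj_def)
  then show False
    using obstruction_freeD[OF assms(1) obstruction.co_P6] by simp
qed

lemma no_co_C6:
  assumes "obstruction_free G"
    and "nonadj G a b" "nonadj G b c" "nonadj G c d" "nonadj G d e" "nonadj G e f" "nonadj G a f"
    and "\<not> nonadj G a c" "\<not> nonadj G a d" "\<not> nonadj G a e"
      "\<not> nonadj G b d" "\<not> nonadj G b e" "\<not> nonadj G b f"
      "\<not> nonadj G c e" "\<not> nonadj G c f" "\<not> nonadj G d f"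
  shows False
proof -
  have "distinct [a, b, c, d, e, f]"
    using assms(2-) by (auto simp: nonadj_commute)
  moreover have "{a, b, c, d, e, f} \<subseteq> verts G"
    using assms(2-) by (auto dest: nonadj_verts)
  ultimately have "induces G [a, b, c, d, e, f] (\<lambda>i j. \<not> cycle_pattern 6 i j)"
    using assms(2-) by (simp add: induces_Cons All_less_Suc nonadj_def cycle_pattern_def)
  then show False
    using obstruction_freeD[OF assms(1) obstruction.co_C6] by simp
qed

lemma no_co_P4_K2:
  assumes "obstruction_free G"
    and "nonadj G a b" "nonadj G b c" "nonadj G c d" "nonadj G e f"
    and "\<not> nonadj G a c" "\<not> nonadj G a d" "\<not> nonadj G b d"
      "\<not> nonadj G a e" "\<not> nonadj G b e" "\<not> nonadj G c e" "\<not> nonadj G d e"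
      "\<not> nonadj G a f" "\<not> nonadj G b f" "\<not> nonadj G c f" "\<not> nonadj G d f"
  shows False
proof -
  have "distinct [a, b, c, d, e, f]"
    using assms(2-) by (auto simp: nonadj_commute)
  moreover have "{a, b, c, d, e, f} \<subseteq> verts G"
    using assms(2-) by (auto dest: nonadj_verts)
  ultimately have "induces G [a, b, c, d, e, f] (\<lambda>i j. \<not> (j = Suc i \<and> i \<noteq> 3))"
    using assms(2-) by (simp add: induces_Cons All_less_Suc nonadj_def)
  then show False
    using obstruction_freeD[OF assms(1) obstruction.co_P4_K2] by simp
qed

lemma no_co_K3_K2:
  assumes "obstruction_free G"
    and "nonadj G a b" "nonadj G b c" "nonadj G a c" "nonadj G d e"
    and "\<not> nonadj G a d" "\<not> nonadj G b d" "\<not> nonadj G c d"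
      "\<not> nonadj G a e" "\<not> nonadj G b e" "\<not> nonadj G c e"
  shows False
proof -
  have "distinct [a, b, c, d, e]"
    using assms(2-) by (auto simp: nonadj_commute)
  moreover have "{a, b, c, d, e} \<subseteq> verts G"
    using assms(2-) by (auto dest: nonadj_verts)
  ultimately have "induces G [a, b, c, d, e] (\<lambda>i j. i < 3 \<and> 3 \<le> j)"
    using assms(2-) by (simp add: induces_Cons All_less_Suc nonadj_def)
  then show False
    using obstruction_freeD[OF assms(1) obstruction.co_K3_K2] by simp
qed

lemma no_long_cycle:
  "obstruction_free G \<Longrightarrow> induces G xs (cycle_pattern (length xs)) \<Longrightarrow> length xs < 5"
  unfolding obstruction_free_def by (meson not_le obstruction.cycle)

lemma nonadj_sym: "nonadj G u v \<Longrightarrow> nonadj G v u"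
  by (simp add: nonadj_commute)

section \<open>Adding a vertex to a difunctional set\<close>

text \<open>
  For edges \<open>a b\<close> and \<open>x y\<close> of a complement with difunctional edge relation, this means that they
  lie in different components.
\<close>
definition apart :: "'a graph \<Rightarrow> 'a \<Rightarrow> 'a \<Rightarrow> 'a \<Rightarrow> 'a \<Rightarrow> bool" where
  "apart G a b x y \<longleftrightarrow>
     \<not> nonadj G a x \<and> \<not> nonadj G a y \<and> \<not> nonadj G b x \<and> \<not> nonadj G b y"

text \<open>
  If \<open>p q\<close> and \<open>r s\<close> lie in different components of the complement, one of the two lies in another
  component than \<open>u v\<close>: otherwise the difunctional law would connect \<open>p q\<close> and \<open>r s\<close> through \<open>u v\<close>.
\<close>
lemma apart_edge_exists:
  assumes di: "difunctional G W" and W: "p \<in> W" "q \<in> W" "r \<in> W" "s \<in> W" "u \<in> W" "v \<in> W"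
    and N: "nonadj G p q" "nonadj G r s" "apart G p q r s" "nonadj G u v"
  obtains x y where "x \<in> W" "y \<in> W" "nonadj G x y" "apart G u v x y"
proof (cases "apart G u v p q")
  case True
  then show ?thesis using that W N by blast
next
  case False
  note shortcut = difunctionalD[OF di] and C = nonadj_sym[of G]
  have "apart G u v r s"
  proof (rule ccontr)
    assume "\<not> apart G u v r s"
    then obtain e f where ef: "e = u \<or> e = v" "f = r \<or> f = s" "nonadj G e f"
      unfolding apart_def by blast
    obtain g h where gh: "g = u \<or> g = v" "h = p \<or> h = q" "nonadj G h g"
      using False C unfolding apart_def by blast
    obtain h' where h': "h' = p \<or> h' = q" "nonadj G h' h" "h' \<in> W"
      using gh N(1) C W by blast
    have hW: "h \<in> W" "g \<in> W" "e \<in> W" "f \<in> W" using ef gh W by blast+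
    show False
    proof (cases "e = g")
      case True
      then have "nonadj G h' f" using shortcut[of h' h g f] h' gh ef hW by blast
      then show False using h' ef N(3) unfolding apart_def by blast
    next
      case False
      then have "nonadj G g e" using ef(1) gh(1) N(4) C by blast
      then have "nonadj G h f" using shortcut[of h g e f] gh ef hW by blast
      then show False using gh ef N(3) unfolding apart_def by blast
    qed
  qed
  then show ?thesis using that W N by blast
qed

text \<open>
  The case in view is a vertex \<open>w\<close> outside \<open>W\<close> adjacent to both of the non-adjacent vertices \<open>u\<close>
  and \<open>v\<close>. In the complement, \<open>u v\<close> is then an edge with no end joined to \<open>w\<close>, and \<open>x y\<close> is an edge
  in another component of \<open>W\<close>, with at most one end joined to \<open>w\<close>. Every failure of the
  difunctional law that involves \<open>w\<close> is a triangle or an induced path on four vertices of the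
  complement. If \<open>u v\<close> or \<open>x y\<close> has no connection to it, they form \<open>K\<^sub>3 \<squnion> K\<^sub>2\<close> or \<open>P\<^sub>4 \<squnion> K\<^sub>2\<close>; if both
  edges are attached to it, there is an induced \<open>P\<^sub>6\<close> with \<open>w\<close> inside.
\<close>
locale added_vertex =
  fixes G :: "'a graph" and W w u v x y
  assumes free: "obstruction_free G" and difun: "difunctional G W"
    and W: "u \<in> W" "v \<in> W" "x \<in> W" "y \<in> W"
    and uv: "nonadj G u v" and xy: "nonadj G x y" and apart: "apart G u v x y"
    and wu: "\<not> nonadj G w u" and wv: "\<not> nonadj G w v"
begin

lemma swap_uv: "added_vertex G W w v u x y"
  using free difun W uv xy apart wu wv
  by (simp add: added_vertex_def apart_def nonadj_commute)

lemma swap_xy: "added_vertex G W w u v y x"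
  using free difun W uv xy apart wu wv
  by (simp add: added_vertex_def apart_def nonadj_commute)

lemmas shortcut = difunctionalD[OF difun]

lemma not_both: "\<not> (nonadj G w x \<and> nonadj G w y)"
  using no_co_K3_K2[OF free, of w x y u v] uv xy apart wu wv by (auto simp: apart_def nonadj_commute)

lemma triangle_free:
  "a \<in> W \<Longrightarrow> b \<in> W \<Longrightarrow> c \<in> W \<Longrightarrow> nonadj G a b \<Longrightarrow> nonadj G b c \<Longrightarrow> \<not> nonadj G a c"
  using shortcut[of a b c a] by (auto simp: nonadj_commute)

lemma linked:
  assumes ab: "a \<in> W" "b \<in> W" "nonadj G a b" and na: "\<not> apart G a b u v"
  shows "nonadj G a v \<and> nonadj G b u \<or> nonadj G a u \<and> nonadj G b v"
proof -
  have ba: "nonadj G b a" and vu: "nonadj G v u" using nonadj_sym[OF ab(3)] nonadj_sym[OF uv] .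
  from na consider "nonadj G a u" | "nonadj G a v" | "nonadj G b u" | "nonadj G b v"
    unfolding apart_def by blast
  then show ?thesis
  proof cases
    case 1 then show ?thesis using shortcut[OF ba 1 uv] ab W by blast
  next
    case 2 then show ?thesis using shortcut[OF ba 2 vu] ab W by blast
  next
    case 3 then show ?thesis using shortcut[OF ab(3) 3 uv] ab W by blast
  next
    case 4 then show ?thesis using shortcut[OF ab(3) 4 vu] ab W by blast
  qed
qed

lemma apart_xy:
  assumes ab: "a \<in> W" "b \<in> W" "nonadj G a b" and na: "\<not> apart G a b u v"
  shows "apart G a b x y"
proof -
  have vu: "nonadj G v u" using nonadj_sym[OF uv] .
  have "\<not> nonadj G a z \<and> \<not> nonadj G b z" if "z = x \<or> z = y" for z
    using linked[OF assms] that apart ab W uv vu nonadj_sym[of G a v] nonadj_sym[of G b u]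
      nonadj_sym[of G a u] nonadj_sym[of G b v]
      shortcut[of u v a z] shortcut[of v u a z] shortcut[of u v b z] shortcut[of v u b z]
    unfolding apart_def by blast
  then show ?thesis unfolding apart_def by blast
qed

text \<open>
  Here \<open>u, a\<close> are on one side and \<open>v, b\<close> on the other side of the same component. If \<open>x\<close>, say, is
  non-adjacent to \<open>w\<close>, then \<open>v, u, b, w, x, y\<close> is an induced path of the complement.
\<close>
lemma no_triangle_linked:
  assumes ab: "a \<in> W" "b \<in> W" "nonadj G w a" "nonadj G w b" "nonadj G a b"
    and l: "nonadj G a v" "nonadj G b u"
  shows False
proof -
  have abxy: "apart G a b x y" using apart_xy[of a b] ab l by (auto simp: apart_def)
  have vb: "\<not> nonadj G v b" using triangle_free[of v a b] l(1) ab W by (auto simp: nonadj_commute)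
  have path: False if "added_vertex G W w u v x' y'" "apart G a b x' y'" "nonadj G w x'" for x' y'
  proof -
    interpret s: added_vertex G W w u v x' y' by fact
    show False
      using no_co_P6[OF free, of v u b w x' y'] s.uv s.xy s.apart s.wu s.wv s.not_both that
        ab l vb by (auto simp: apart_def nonadj_commute)
  qed
  consider "nonadj G w x" | "nonadj G w y" | "\<not> nonadj G w x" "\<not> nonadj G w y" by blast
  then show False
  proof cases
    case 1 then show False using path[OF added_vertex_axioms abxy] by blast
  next
    case 2
    have "apart G a b y x" using abxy by (simp add: apart_def)
    then show False using path[OF swap_xy] 2 by blast
  next
    case 3
    then show False
      using no_co_K3_K2[OF free, of w a b x y] ab xy abxy by (auto simp: apart_def nonadj_commute)
  qed
qed

lemma no_triangle:
  assumes ab: "a \<in> W" "b \<in> W" "nonadj G w a" "nonadj G w b" "nonadj G a b"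
  shows False
proof (cases "apart G a b u v")
  case True
  then show False
    using no_co_K3_K2[OF free, of w a b u v] ab uv wu wv by (auto simp: apart_def nonadj_commute)
next
  case False
  then consider "nonadj G a v" "nonadj G b u" | "nonadj G a u" "nonadj G b v"
    using linked[OF ab(1,2,5)] by blast
  then show False
  proof cases
    case 1 then show False using no_triangle_linked ab by blast
  next
    case 2 then show False using added_vertex.no_triangle_linked[OF swap_uv] ab by blast
  qed
qed

text \<open>
  If \<open>u v\<close> lies in the component of \<open>a, b, c\<close>, the edge \<open>x y\<close> does not, and it either extends the
  path \<open>w, a, b, c\<close> beyond \<open>w\<close> to a \<open>P\<^sub>6\<close> or is separate from it.
\<close>
lemma no_path_from:
  assumes abc: "a \<in> W" "b \<in> W" "c \<in> W" "nonadj G w a" "nonadj G a b" "nonadj G b c"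
    and n: "\<not> nonadj G w b" "\<not> nonadj G w c"
  shows False
proof -
  have ac: "\<not> nonadj G a c" using triangle_free abc by blast
  have c: "\<not> nonadj G c z" if "z \<in> W" "z' \<in> W" "nonadj G z z'" "apart G a b z z'" for z z'
    using shortcut[of b c z z'] that abc by (auto simp: apart_def nonadj_commute)
  have c': "\<not> nonadj G c z'" if "z \<in> W" "z' \<in> W" "nonadj G z z'" "apart G a b z z'" for z z'
    using shortcut[of b c z' z] that abc by (auto simp: apart_def nonadj_commute)
  show False
  proof (cases "apart G a b u v")
    case True
    then show False
      using no_co_P4_K2[OF free, of w a b c u v] abc n ac uv wu wv c[of u v] c'[of u v] W
      by (auto simp: apart_def nonadj_commute)
  next
    case False
    have ap: "apart G a b x y" using apart_xy False abc by blast
    have path: False if "nonadj G w x'" "\<not> nonadj G w y'" "nonadj G x' y'" "apart G a b x' y'"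
      "x' \<in> W" "y' \<in> W" for x' y'
      using no_co_P6[OF free, of y' x' w a b c] that c[of x' y'] c'[of x' y'] abc n ac
      by (auto simp: apart_def nonadj_commute)
    have ap': "apart G a b y x" using ap by (simp add: apart_def)
    consider "nonadj G w x" "\<not> nonadj G w y" | "nonadj G w y" "\<not> nonadj G w x"
      | "\<not> nonadj G w x" "\<not> nonadj G w y"
      using not_both by blast
    then show False
    proof cases
      case 1 then show False using path[OF 1 xy ap W(3,4)] by blast
    next
      case 2 then show False using path[OF 2 nonadj_sym[OF xy] ap' W(4,3)] by (auto simp: nonadj_commute)
    next
      case 3
      then show False
        using no_co_P4_K2[OF free, of w a b c x y] abc n ac xy ap c[of x y] c'[of x y] W
        by (auto simp: apart_def nonadj_commute)
    qed
  qed
qed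

text \<open>
  The following three lemmas exclude the path \<open>a, w, b, c\<close> with \<open>w\<close> as an inner vertex, by the
  component of \<open>u v\<close>: that of \<open>a\<close>, that of \<open>b\<close> and \<open>c\<close>, or neither. In the first case
  \<open>u, v, a, w, b, c\<close> is a \<open>P\<^sub>6\<close>.
\<close>
lemma no_path_through_linked_first:
  assumes abc: "a \<in> W" "b \<in> W" "c \<in> W" "nonadj G w a" "nonadj G w b" "nonadj G b c"
    and n: "\<not> nonadj G a b" "\<not> nonadj G a c" "\<not> nonadj G w c"
    and av: "nonadj G a v"
  shows False
proof -
  have "\<not> nonadj G u a" using triangle_free[of u v a] av abc W uv by (auto simp: nonadj_commute)
  moreover have "\<not> nonadj G u b" using shortcut[of b u v a] av abc W uv n by (auto simp: nonadj_commute)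
  moreover have "\<not> nonadj G u c" using shortcut[of c u v a] av abc W uv n by (auto simp: nonadj_commute)
  moreover have "\<not> nonadj G v b" using shortcut[of a v b c] av abc W uv n by (auto simp: nonadj_commute)
  moreover have "\<not> nonadj G v c" using shortcut[of a v c b] av abc W uv n by (auto simp: nonadj_commute)
  ultimately show False
    using no_co_P6[OF free, of u v a w b c] abc n av uv wu wv by (auto simp: nonadj_commute)
qed

text \<open>
  In the second case \<open>c\<close> can be replaced by \<open>v\<close>, and the path \<open>a, w, b, v\<close> extends to \<open>u\<close>. Then
  \<open>x y\<close> is separate from \<open>a, w, b, v\<close>, or one of its vertices extends \<open>a, w, b, v, u\<close> beyond \<open>a\<close>, or
  the whole edge can be put in place of \<open>a\<close> in front of \<open>w\<close>.
\<close>
lemma no_path_through_linked_last: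
  assumes ab: "a \<in> W" "b \<in> W" "nonadj G w a" "nonadj G w b"
    and n: "\<not> nonadj G a b" "\<not> nonadj G a u" "\<not> nonadj G a v"
    and bv: "nonadj G b v"
  shows False
proof -
  have bu: "\<not> nonadj G b u" using triangle_free[of b v u] bv ab W uv by (auto simp: nonadj_commute)
  have bx: "\<not> nonadj G b x" using shortcut[of u v b x] bv ab W uv apart by (auto simp: apart_def nonadj_commute)
  have bY: "\<not> nonadj G b y" using shortcut[of u v b y] bv ab W uv apart by (auto simp: apart_def nonadj_commute)
  have path: False if "nonadj G w x'" "\<not> nonadj G w y'" "nonadj G x' y'" "apart G u v x' y'"
    "\<not> nonadj G b x'" "\<not> nonadj G b y'" for x' y'
    using no_co_P6[OF free, of y' x' w b v u] that bu bv ab wu wv uv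
    by (auto simp: apart_def nonadj_commute)
  have path': False if "nonadj G a x'" "\<not> nonadj G w x'" "apart G u v x' y'"
    "\<not> nonadj G b x'" for x' y'
    using no_co_P6[OF free, of x' a w b v u] that bu bv ab n wu wv uv
    by (auto simp: apart_def nonadj_commute)
  have apart': "apart G u v y x" using apart by (simp add: apart_def)
  consider "nonadj G w x" "\<not> nonadj G w y" | "nonadj G w y" "\<not> nonadj G w x"
    | "\<not> nonadj G w x" "\<not> nonadj G w y"
    using not_both by blast
  then show False
  proof cases
    case 1 then show False using path[OF 1 xy apart bx bY] by blast
  next
    case 2 then show False using path[OF 2 nonadj_sym[OF xy] apart' bY bx] by (auto simp: nonadj_commute)
  next
    case 3
    then show False
      using path'[of x y] path'[of y x] apart apart' bx bY
        no_co_P4_K2[OF free, of a w b v x y] ab n bv wv xy by (auto simp: apart_def nonadj_commute)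
  qed
qed

lemma no_path_through:
  assumes abc: "a \<in> W" "b \<in> W" "c \<in> W" "nonadj G w a" "nonadj G w b" "nonadj G b c"
    and ac: "\<not> nonadj G a c"
  shows False
proof -
  have n: "\<not> nonadj G a b" "\<not> nonadj G w c" using no_triangle abc by blast+
  show False
  proof (cases "nonadj G a u \<or> nonadj G a v")
    case True
    then show False
      using no_path_through_linked_first[of a b c]
        added_vertex.no_path_through_linked_first[OF swap_uv, of a b c] abc ac n by blast
  next
    case a: False
    show False
    proof (cases "nonadj G b u \<or> nonadj G b v")
      case True
      then show False
        using no_path_through_linked_last[of a b]
          added_vertex.no_path_through_linked_last[OF swap_uv, of a b] abc ac n a by blast
    next
      case b: False
      have "\<not> nonadj G c u" "\<not> nonadj G c v"
        using shortcut[of b c u v] shortcut[of b c v u] b abc W uv by (auto simp: nonadj_commute)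
      then show False
        using no_co_P4_K2[OF free, of a w b c u v] abc ac n a b wu wv uv by (auto simp: nonadj_commute)
    qed
  qed
qed

lemma difunctional_insert: "difunctional G (insert w W)"
  unfolding difunctional_def
proof (intro ballI impI)
  fix a b c d
  assume mem: "a \<in> insert w W" "b \<in> insert w W" "c \<in> insert w W" "d \<in> insert w W"
    and N: "nonadj G a b" "nonadj G b c" "nonadj G c d"
  have start: "nonadj G w d'" if "b' \<in> W" "c' \<in> W" "d' \<in> W"
    "nonadj G w b'" "nonadj G b' c'" "nonadj G c' d'" for b' c' d'
    using no_triangle[of b' c'] no_path_from[of b' c' d'] that by blast
  have mid: "nonadj G a' d'" if "a' \<in> W" "c' \<in> W" "d' \<in> W"
    "nonadj G w a'" "nonadj G w c'" "nonadj G c' d'" for a' c' d'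
    using no_path_through[of a' c' d'] that by blast
  have ne: "a \<noteq> b" "b \<noteq> c" "c \<noteq> d" using N by auto
  consider "a \<in> W" "b \<in> W" "c \<in> W" "d \<in> W" | "a = w" | "d = w" | "b = w" "a \<in> W" "d \<in> W"
    | "c = w" "a \<in> W" "d \<in> W"
    using mem by blast
  then show "nonadj G a d"
  proof cases
    case 1 then show ?thesis using shortcut N by blast
  next
    case 2
    then show ?thesis
      using start[of b c d] no_triangle[of b c] N ne mem by (auto simp: nonadj_commute)
  next
    case 3
    then show ?thesis
      using start[of c b a] no_triangle[of b c] N ne mem by (auto simp: nonadj_commute)
  next
    case 4
    then show ?thesis using mid[of a c d] N ne mem by (auto simp: nonadj_commute)
  next
    case 5
    then show ?thesis using mid[of d b a] N ne mem by (auto simp: nonadj_commute)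
  qed
qed

end

section \<open>Shortest bypasses\<close>

text \<open>
  A walk through the outside of \<open>W\<close> between two non-adjacent vertices of \<open>W\<close>; only its inner
  vertices are listed in \<open>ps\<close>.
\<close>
definition bypass :: "'a graph \<Rightarrow> 'a set \<Rightarrow> 'a \<Rightarrow> 'a list \<Rightarrow> 'a \<Rightarrow> bool" where
  "bypass G W u ps v \<longleftrightarrow> u \<in> W \<and> v \<in> W \<and> nonadj G u v \<and>
     ps \<noteq> [] \<and> set ps \<subseteq> verts G - W \<and>
     (\<forall>i. Suc i < length ps \<longrightarrow> adjacent G (ps ! i) (ps ! Suc i)) \<and>
     adjacent G u (hd ps) \<and> adjacent G (last ps) v"

text \<open>
  If there is no bypass, the vertices of \<open>W\<close> to which the component \<open>K\<close> of \<open>b\<close> outside \<open>W\<close> is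
  attached are pairwise adjacent, so this clique cuts off \<open>K\<close>. The last property shows that a vertex
  of \<open>W\<close> without neighbours outside \<open>W\<close> is not in \<open>U\<close>, which serves to see that \<open>U\<close> is not
  everything.
\<close>
lemma separation_or_bypass:
  assumes G: "finite_simple_graph G" and b: "b \<in> verts G - W"
    and no: "\<nexists>u ps v. bypass G W u ps v" and W: "W \<subseteq> verts G"
  obtains U V where "separation G U V" "b \<notin> V" "W \<subseteq> V"
    "\<And>s. s \<in> W \<Longrightarrow> s \<in> U \<Longrightarrow> \<exists>k\<in>verts G - W. adjacent G s k"
proof -
  define E where "E p q \<longleftrightarrow> p \<in> verts G - W \<and> q \<in> verts G - W \<and> adjacent G p q" for p q
  define K where "K = {k. E\<^sup>*\<^sup>* b k}"
  define S where "S = {s \<in> W. \<exists>k\<in>K. adjacent G s k}"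
  have K: "K \<subseteq> verts G - W"
  proof
    fix k assume "k \<in> K"
    then have "E\<^sup>*\<^sup>* b k" by (simp add: K_def)
    then show "k \<in> verts G - W" using b by cases (auto simp: E_def)
  qed
  have walk: "\<exists>ps. ps \<noteq> [] \<and> set ps \<subseteq> verts G - W \<and> hd ps = p \<and> last ps = q \<and>
      (\<forall>i. Suc i < length ps \<longrightarrow> adjacent G (ps ! i) (ps ! Suc i))"
    if "E\<^sup>*\<^sup>* p q" "p \<in> verts G - W" for p q
    using that
  proof (induction rule: rtranclp_induct)
    case base
    then show ?case by (intro exI[of _ "[p]"]) auto
  next
    case (step q r)
    then obtain ps where ps: "ps \<noteq> []" "set ps \<subseteq> verts G - W" "hd ps = p" "last ps = q"
      "\<forall>i. Suc i < length ps \<longrightarrow> adjacent G (ps ! i) (ps ! Suc i)" by blast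
    have "adjacent G ((ps @ [r]) ! i) ((ps @ [r]) ! Suc i)" if i: "Suc i < length (ps @ [r])" for i
    proof (cases "Suc i < length ps")
      case True
      then show ?thesis using ps(5) by (simp add: nth_append)
    next
      case False
      then have "i = length ps - 1" using i ps(1) by (cases ps) auto
      then show ?thesis using ps step(2) by (simp add: nth_append last_conv_nth E_def)
    qed
    moreover have "r \<in> verts G - W" using step(2) by (simp add: E_def)
    ultimately show ?case using ps by (intro exI[of _ "ps @ [r]"]) auto
  qed
  have "symp E" by (auto simp: symp_def E_def adjacent_commute)
  then have sym: "E\<^sup>*\<^sup>* q p" if "E\<^sup>*\<^sup>* p q" for p q
    using that by (metis sympD symp_rtranclp)
  have clq: "clique G S"
    unfolding clique_def
  proof (intro conjI ballI impI)
    show "S \<subseteq> verts G" using W by (auto simp: S_def)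
    fix u v assume uv: "u \<in> S" "v \<in> S" "u \<noteq> v"
    then obtain k l where kl: "k \<in> K" "l \<in> K" "adjacent G u k" "adjacent G v l"
      by (auto simp: S_def)
    then have "E\<^sup>*\<^sup>* k l"
      using sym[of b k] by (auto simp: K_def)
    then obtain ps where ps: "ps \<noteq> []" "set ps \<subseteq> verts G - W" "hd ps = k" "last ps = l"
      "\<forall>i. Suc i < length ps \<longrightarrow> adjacent G (ps ! i) (ps ! Suc i)"
      using walk[of k l] K kl by blast
    show "adjacent G u v"
    proof (rule ccontr)
      assume "\<not> adjacent G u v"
      then have "nonadj G u v" using uv W by (auto simp: nonadj_def S_def)
      then have "bypass G W u ps v"
        using ps uv kl adjacent_commute[of G v l] by (simp add: bypass_def S_def)
      then show False using no by blast
    qed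
  qed
  have step: "t \<in> K" if "k \<in> K" "adjacent G k t" "t \<notin> W" for k t
  proof -
    have "E k t" using that K adjacentD[OF G that(2)] by (auto simp: E_def)
    then show ?thesis using that(1) by (auto simp: K_def intro: rtranclp.rtrancl_into_rtrancl)
  qed
  have "S \<subseteq> W" by (auto simp: S_def)
  have int: "(K \<union> S) \<inter> (verts G - K) = S" using K W \<open>S \<subseteq> W\<close> by blast
  have noedge: "\<not> adjacent G k t" if "k \<in> K" "t \<notin> K \<union> S" for k t
  proof
    assume a: "adjacent G k t"
    have "t \<notin> W" using a that by (auto simp: S_def adjacent_commute)
    then show False using step a that by blast
  qed
  show thesis
  proof
    show "separation G (K \<union> S) (verts G - K)"
      unfolding separation_def int using clq noedge K W \<open>S \<subseteq> W\<close> by blast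
    show "b \<notin> verts G - K" by (simp add: K_def)
    show "W \<subseteq> verts G - K" using K W by blast
    show "\<exists>k\<in>verts G - W. adjacent G s k" if "s \<in> W" "s \<in> K \<union> S" for s
      using that K by (auto simp: S_def)
  qed
qed

text \<open>
  Minimality is required among all bypasses of \<open>W\<close>, not only those between \<open>u\<close> and \<open>v\<close>: this
  restricts how other vertices of \<open>W\<close> can be adjacent to the path.
\<close>
locale shortest_bypass =
  fixes G :: "'a graph" and W u ps v
  assumes simple: "finite_simple_graph G" and bypass: "bypass G W u ps v"
    and shortest: "\<And>u' ps' v'. bypass G W u' ps' v' \<Longrightarrow> length ps \<le> length ps'"
begin

abbreviation "m \<equiv> length ps"

lemma bypass_facts:
  "u \<in> W" "v \<in> W" "nonadj G u v" "0 < m" "set ps \<subseteq> verts G - W"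
  "adjacent G u (ps ! 0)" "adjacent G (ps ! (m - 1)) v"
  using bypass by (auto simp: bypass_def hd_conv_nth last_conv_nth)

lemma step: "Suc i < m \<Longrightarrow> adjacent G (ps ! i) (ps ! Suc i)"
  using bypass by (simp add: bypass_def)

lemma outside: "i < m \<Longrightarrow> ps ! i \<in> verts G \<and> ps ! i \<notin> W"
  using bypass_facts(5) nth_mem[of i ps] by blast

text \<open>
  Otherwise a proper segment of \<open>ps\<close> would be a shorter bypass, between \<open>u'\<close> and \<open>v'\<close>.
\<close>
lemma attachments_at_ends:
  assumes "u' \<in> W" "v' \<in> W" "nonadj G u' v'" "adjacent G u' (ps ! i)" "adjacent G v' (ps ! j)"
    and "i \<le> j" "j < m"
  shows "i = 0 \<and> j = m - 1"
proof -
  define qs where "qs = take (Suc j - i) (drop i ps)"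
  have len: "length qs = Suc j - i" using assms by (simp add: qs_def)
  then have "qs \<noteq> []" using assms by auto
  have nth: "qs ! k = ps ! (i + k)" if "k < length qs" for k
    using that len assms by (simp add: qs_def)
  have "set qs \<subseteq> set ps" unfolding qs_def by (meson set_drop_subset set_take_subset subset_trans)
  then have "bypass G W u' qs v'"
    using assms bypass_facts(5) step \<open>qs \<noteq> []\<close> nth len
    by (auto simp: bypass_def hd_conv_nth last_conv_nth adjacent_commute[of G v'])
  then have "m \<le> Suc j - i" using shortest len by force
  then show ?thesis using assms by auto
qed

lemma no_chord:
  assumes "Suc i < j" "j < m"
  shows "\<not> adjacent G (ps ! i) (ps ! j)"
proof
  assume a: "adjacent G (ps ! i) (ps ! j)"
  define qs where "qs = take (Suc i) ps @ drop j ps"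
  have len: "length qs = Suc i + (m - j)" using assms by (simp add: qs_def)
  have "adjacent G (qs ! k) (qs ! Suc k)" if k: "Suc k < length qs" for k
  proof -
    consider "k < i" | "k = i" | "i < k" by linarith
    then show ?thesis
    proof cases
      case 1 then show ?thesis using assms step[of k] by (simp add: qs_def nth_append)
    next
      case 2 then show ?thesis using assms a by (simp add: qs_def nth_append)
    next
      case 3
      then have "qs ! k = ps ! (j + (k - Suc i))" "qs ! Suc k = ps ! Suc (j + (k - Suc i))"
        using assms k len by (auto simp: qs_def nth_append Suc_diff_Suc Suc_diff_le)
      then show ?thesis using step[of "j + (k - Suc i)"] 3 k len assms by simp
    qed
  qed
  moreover have "qs \<noteq> []" "hd qs = ps ! 0" "last qs = ps ! (m - 1)"
    using assms by (auto simp: qs_def hd_conv_nth last_conv_nth nth_append)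
  moreover have "set qs \<subseteq> set ps"
    unfolding qs_def by (auto dest: in_set_takeD in_set_dropD)
  ultimately have "bypass G W u qs v"
    using bypass_facts by (auto simp: bypass_def)
  then show False using shortest[of u qs v] len assms by simp
qed

lemma end_u: "i < m \<Longrightarrow> adjacent G u (ps ! i) \<longleftrightarrow> i = 0"
  using attachments_at_ends[of u v i "m - 1"] bypass_facts adjacent_commute[of G v] by auto

lemma end_v: "i < m \<Longrightarrow> adjacent G (ps ! i) v \<longleftrightarrow> Suc i = m"
  using attachments_at_ends[of u v 0 i] bypass_facts(1-3,6,7) adjacent_commute[of G v "ps ! i"]
    diff_Suc_1[of i] by (metis Suc_pred' bypass_facts(4) le0)

text \<open>
  The successor of the later occurrence of a repeated vertex would be the far end of a chord; at the
  end of the path, \<open>v\<close> takes the place of the successor.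
\<close>
lemma distinct: "i < j \<Longrightarrow> j < m \<Longrightarrow> ps ! i \<noteq> ps ! j"
proof
  assume ij: "i < j" "j < m" and eq: "ps ! i = ps ! j"
  show False
  proof (cases "Suc j < m")
    case True
    then show False using step[of j] no_chord[of i "Suc j"] ij eq by simp
  next
    case False
    then show False using end_v[of i] end_v[of j] ij eq by simp
  qed
qed

lemma induces_ps: "induces G ps (\<lambda>i j. j = Suc i)"
proof -
  have "distinct ps"
    unfolding distinct_conv_nth using distinct by (metis linorder_neqE_nat)
  moreover have "adjacent G (ps ! i) (ps ! j) \<longleftrightarrow> j = Suc i" if "i < j" "j < m" for i j
    using step[of i] no_chord[of i j] that by (cases "j = Suc i") auto
  ultimately show ?thesis using bypass_facts(5) by (auto simp: induces_def)
qed

lemma induces_ps_v: "induces G (ps @ [v]) (\<lambda>i j. j = Suc i)"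
  using induces_ps bypass_facts end_v nonadj_verts[OF bypass_facts(3)]
  by (auto simp: induces_snoc)

lemma induces_u_ps_v: "induces G (u # ps @ [v]) (\<lambda>i j. j = Suc i)"
proof -
  have "adjacent G u ((ps @ [v]) ! j) \<longleftrightarrow> j = 0" if "j < length (ps @ [v])" for j
    using that end_u bypass_facts by (cases "j < m") (auto simp: nth_append nonadj_def less_Suc_eq)
  moreover have "u \<notin> set ps" "u \<noteq> v" using bypass_facts by (auto simp: nonadj_def)
  ultimately show ?thesis
    using induces_ps_v nonadj_verts[OF bypass_facts(3)] by (simp add: induces_Cons)
qed

end

lemma induces_close_path:
  assumes path: "induces G qs (\<lambda>i j. j = Suc i)" and z: "z \<in> verts G" "z \<notin> set qs"
    and adj: "\<And>i. i < length qs \<Longrightarrow> adjacent G z (qs ! i) \<longleftrightarrow> i = 0 \<or> Suc i = length qs"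
  shows "induces G (z # qs) (cycle_pattern (length (z # qs)))"
proof -
  have "induces G qs (\<lambda>i j. cycle_pattern (length (z # qs)) (Suc i) (Suc j))"
    using path by (simp add: cycle_pattern_def)
  then show ?thesis
    using z adj by (auto simp: induces_Cons cycle_pattern_def)
qed

context shortest_bypass
begin

text \<open>
  Otherwise \<open>z, u, ps, v\<close> is an induced cycle of length at least five.
\<close>
lemma single_vertex_if_free_common_neighbour:
  assumes free: "obstruction_free G"
    and z: "z \<in> W" "adjacent G z u" "adjacent G z v" "\<And>i. i < m \<Longrightarrow> \<not> adjacent G z (ps ! i)"
  shows "m = 1"
proof -
  have "z \<in> verts G" "z \<noteq> u" "z \<noteq> v" using adjacentD[OF simple] z by blast+
  then have "induces G (z # u # ps @ [v]) (cycle_pattern (length (z # u # ps @ [v])))"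
    using z bypass_facts(5)
    by (intro induces_close_path induces_u_ps_v) (auto simp: nth_Cons nth_append split: nat.splits)
  then have "length (z # u # ps @ [v]) < 5" by (rule no_long_cycle[OF free])
  then have "m < 2" by simp
  then show ?thesis using bypass_facts(4) by linarith
qed

text \<open>
  For at least three inner vertices \<open>x, ps, v\<close> is an induced cycle of length at least five. For two
  inner vertices \<open>p\<close> and \<open>q\<close> there is a prism with triangles \<open>u, x, p\<close> and \<open>y, v, q\<close>, whose
  complement is the six-cycle \<open>u, v, p, y, x, q\<close>.
\<close>
lemma single_vertex_if_apart_edge_oriented:
  assumes free: "obstruction_free G"
    and xy: "x \<in> W" "y \<in> W" "nonadj G x y" "apart G u v x y"
    and distinct: "x \<noteq> u" "x \<noteq> v" "y \<noteq> u" "y \<noteq> v"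
    and x: "\<And>i. i < m \<Longrightarrow> adjacent G x (ps ! i) \<longleftrightarrow> i = 0"
    and y: "\<And>i. i < m \<Longrightarrow> adjacent G y (ps ! i) \<longleftrightarrow> Suc i = m"
  shows "m = 1"
proof (rule ccontr)
  assume "m \<noteq> 1"
  then have m: "m \<ge> 2" using bypass_facts(4) by linarith
  have V: "x \<in> verts G" "y \<in> verts G" "u \<in> verts G" "v \<in> verts G"
    using nonadj_verts[OF xy(3)] nonadj_verts[OF bypass_facts(3)] by blast+
  have "adjacent G x v" using V xy distinct
    by (auto simp: adjacent_iff_not_nonadj apart_def nonadj_commute)
  have "x \<notin> set (ps @ [v])" using xy bypass_facts(5) distinct by auto
  have "adjacent G x ((ps @ [v]) ! i) \<longleftrightarrow> i = 0 \<or> Suc i = length (ps @ [v])"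
    if "i < length (ps @ [v])" for i
    using that x[of i] \<open>adjacent G x v\<close> by (auto simp: nth_append less_Suc_eq)
  then have "length (x # ps @ [v]) < 5"
    by (intro no_long_cycle[OF free] induces_close_path induces_ps_v V \<open>x \<notin> set (ps @ [v])\<close>)
  then have "m = 2" using m by simp
  define p q where "p = ps ! 0" and "q = ps ! 1"
  have pq: "p \<in> verts G" "q \<in> verts G" "p \<notin> W" "q \<notin> W"
    using outside[of 0] outside[of 1] \<open>m = 2\<close> by (auto simp: p_def q_def)
  have ne: "x \<noteq> p" "x \<noteq> q" "y \<noteq> p" "y \<noteq> q" "u \<noteq> p" "u \<noteq> q" "v \<noteq> p" "v \<noteq> q"
    using pq xy bypass_facts by auto
  have adj: "adjacent G x p" "\<not> adjacent G x q" "\<not> adjacent G y p" "adjacent G y q"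
    "adjacent G u p" "\<not> adjacent G u q" "\<not> adjacent G v p" "adjacent G v q" "adjacent G p q"
    using x[of 0] x[of 1] y[of 0] y[of 1] end_u[of 0] end_u[of 1] end_v[of 0] end_v[of 1] step[of 0]
      \<open>m = 2\<close> adjacent_commute[of G v] by (auto simp: p_def q_def)
  have N: "nonadj G v p" "nonadj G y p" "nonadj G x q" "nonadj G u q"
    "\<not> nonadj G x p" "\<not> nonadj G y q" "\<not> nonadj G u p" "\<not> nonadj G v q" "\<not> nonadj G p q"
    using adj ne V pq by (auto simp: nonadj_def)
  show False
    using no_co_C6[OF free, of u v p y x q] N xy(3,4) bypass_facts(3)
    by (auto simp: apart_def nonadj_commute)
qed

text \<open>
  If \<open>ps\<close> has at least two vertices, each of \<open>x\<close> and \<open>y\<close> has a neighbour on it by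
  \<open>single_vertex_if_free_common_neighbour\<close>. As they are non-adjacent, \<open>attachments_at_ends\<close> leaves
  only one end of \<open>ps\<close> for \<open>x\<close> and the other end for \<open>y\<close>.
\<close>
lemma single_vertex_if_apart_edge:
  assumes free: "obstruction_free G"
    and xy: "x \<in> W" "y \<in> W" "nonadj G x y" "apart G u v x y"
  shows "m = 1"
proof (rule ccontr)
  assume m: "m \<noteq> 1"
  have V: "x \<in> verts G" "y \<in> verts G" "u \<in> verts G" "v \<in> verts G"
    using nonadj_verts[OF xy(3)] nonadj_verts[OF bypass_facts(3)] by blast+
  have distinct: "x \<noteq> u" "x \<noteq> v" "y \<noteq> u" "y \<noteq> v"
    using xy(3,4) bypass_facts(3) by (auto simp: apart_def nonadj_commute)
  have adj: "adjacent G z u" "adjacent G z v" if "z = x \<or> z = y" for z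
    using that V distinct xy(4) by (auto simp: adjacent_iff_not_nonadj apart_def nonadj_commute)
  obtain i where i: "i < m" "adjacent G x (ps ! i)"
    using single_vertex_if_free_common_neighbour[OF free xy(1)] adj m by blast
  obtain j where j: "j < m" "adjacent G y (ps ! j)"
    using single_vertex_if_free_common_neighbour[OF free xy(2)] adj m by blast
  have yx: "nonadj G y x" using nonadj_sym[OF xy(3)] .
  have ends: "k = 0 \<and> l = m - 1 \<or> l = 0 \<and> k = m - 1"
    if "k < m" "adjacent G x (ps ! k)" "l < m" "adjacent G y (ps ! l)" for k l
    using attachments_at_ends[OF xy(1,2,3) that(2,4)] attachments_at_ends[OF xy(2,1) yx that(4,2)] that
    by linarith
  have apart': "apart G u v y x" using xy(4) by (simp add: apart_def)
  from ends[OF i j] show False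
  proof
    assume ij: "i = 0 \<and> j = m - 1"
    have "m = 1"
    proof (rule single_vertex_if_apart_edge_oriented[OF free xy distinct])
      show "adjacent G x (ps ! k) \<longleftrightarrow> k = 0" if "k < m" for k
        using ends[OF that _ j] i ij m by auto
      show "adjacent G y (ps ! k) \<longleftrightarrow> Suc k = m" if "k < m" for k
      proof -
        have "Suc k = m \<longleftrightarrow> k = m - 1" using that by linarith
        then show ?thesis using ends[OF i that] j ij m by auto
      qed
    qed
    then show False using m by simp
  next
    assume ij: "j = 0 \<and> i = m - 1"
    have "m = 1"
    proof (rule single_vertex_if_apart_edge_oriented[OF free xy(2,1) yx apart' distinct(3,4,1,2)])
      show "adjacent G y (ps ! k) \<longleftrightarrow> k = 0" if "k < m" for k
        using ends[OF i that] j ij m by auto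
      show "adjacent G x (ps ! k) \<longleftrightarrow> Suc k = m" if "k < m" for k
      proof -
        have "Suc k = m \<longleftrightarrow> k = m - 1" using that by linarith
        then show ?thesis using ends[OF that _ j] i ij m by auto
      qed
    qed
    then show False using m by simp
  qed
qed

end

lemma shortest_bypass_exists:
  assumes "finite_simple_graph G" "bypass G W u ps v"
  obtains u' ps' v' where "shortest_bypass G W u' ps' v'"
proof -
  obtain n where n: "\<exists>u ps v. bypass G W u ps v \<and> length ps = n"
    and min: "\<And>k. \<exists>u ps v. bypass G W u ps v \<and> length ps = k \<Longrightarrow> n \<le> k"
    using exists_least_iff[of "\<lambda>n. \<exists>u ps v. bypass G W u ps v \<and> length ps = n"] assms(2)
    by (metis linorder_not_less)
  then obtain u' ps' v' where "bypass G W u' ps' v'" "length ps' = n" by blast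
  then have "shortest_bypass G W u' ps' v'"
    using assms(1) min by unfold_locales blast+
  then show thesis by (rule that)
qed

section \<open>Decomposing a graph without forbidden subgraphs\<close>

definition proper_separation :: "'a graph \<Rightarrow> 'a set \<Rightarrow> 'a set \<Rightarrow> bool" where
  "proper_separation G U V \<longleftrightarrow> separation G U V \<and> U \<noteq> verts G \<and> V \<noteq> verts G"

text \<open>
  With \<open>W\<close> the closed neighbourhood of \<open>a\<close>, a shortest bypass of \<open>W\<close> closes up with \<open>a\<close> to an
  induced cycle. The conclusion says that \<open>a, u, p, v\<close> is an induced four-cycle.
\<close>
lemma four_cycle_exists:
  assumes G: "finite_simple_graph G" and free: "obstruction_free G"
    and no: "\<nexists>U V. proper_separation G U V" and ab: "nonadj G a b"
  obtains p u v where "nonadj G a p" "nonadj G u v" "apart G a p u v"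
proof -
  define W where "W = insert a {v. adjacent G a v}"
  have W: "W \<subseteq> verts G" using ab adjacentD[OF G] by (auto simp: W_def nonadj_def)
  have b: "b \<in> verts G - W" using ab by (auto simp: W_def nonadj_def)
  have "\<exists>u ps v. bypass G W u ps v"
  proof (rule ccontr)
    assume nb: "\<nexists>u ps v. bypass G W u ps v"
    obtain U V where UV: "separation G U V" "b \<notin> V" "W \<subseteq> V"
      "\<And>s. s \<in> W \<Longrightarrow> s \<in> U \<Longrightarrow> \<exists>k\<in>verts G - W. adjacent G s k"
      by (rule separation_or_bypass[OF G b nb W]) (rule that)
    \<comment> \<open>All neighbours of \<open>a\<close> lie in \<open>W\<close>.\<close>
    have "a \<notin> U" using UV(4)[of a] by (auto simp: W_def)
    then have "proper_separation G U V"
      using UV b W by (auto simp: proper_separation_def W_def)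
    then show False using no by blast
  qed
  then obtain u ps v where "shortest_bypass G W u ps v"
    using shortest_bypass_exists[OF G] by metis
  then interpret shortest_bypass G W u ps v .
  have "u \<noteq> a" "v \<noteq> a"
    using bypass_facts(1,2,3) by (auto simp: W_def nonadj_def adjacent_commute)
  then have au: "adjacent G a u" and av: "adjacent G a v"
    using bypass_facts(1,2) by (auto simp: W_def)
  have aps: "\<not> adjacent G a (ps ! i)" if "i < m" for i
    using outside[OF that] by (auto simp: W_def)
  have m: "m = 1"
    using single_vertex_if_free_common_neighbour[OF free _ au av aps] by (simp add: W_def)
  show thesis
  proof
    show "nonadj G a (ps ! 0)"
      using outside[of 0] aps[of 0] m ab by (auto simp: nonadj_def W_def)
    show "nonadj G u v" by (rule bypass_facts)
    show "apart G a (ps ! 0) u v"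
      using au av bypass_facts(6,7) m by (simp add: apart_def nonadj_def adjacent_commute)
  qed
qed

text \<open>
  Starting from a four-cycle, a maximal difunctional set \<open>W\<close> is taken; a shortest bypass of \<open>W\<close> has
  a single inner vertex, and this vertex could be added to \<open>W\<close>.
\<close>
lemma proper_separation_exists:
  assumes G: "finite_simple_graph G" and free: "obstruction_free G"
    and nd: "\<not> difunctional G (verts G)"
  shows "\<exists>U V. proper_separation G U V"
proof (rule ccontr)
  assume no: "\<nexists>U V. proper_separation G U V"
  obtain a b where "nonadj G a b" using nd by (auto simp: difunctional_def)
  then obtain p r s where N: "nonadj G a p" "nonadj G r s" "apart G a p r s"
    using four_cycle_exists[OF G free no] by metis
  let ?C = "{a, p, r, s}"
  have C: "?C \<subseteq> verts G" using nonadj_verts[OF N(1)] nonadj_verts[OF N(2)] by blast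
  have "nonadj G p a" "nonadj G s r" "\<not> nonadj G r a" "\<not> nonadj G s a" "\<not> nonadj G r p" "\<not> nonadj G s p"
    using N by (auto simp: apart_def nonadj_commute)
  then have "difunctional G ?C"
    using N by (simp add: difunctional_def apart_def)
  moreover have "finite {U. U \<subseteq> verts G \<and> difunctional G U}"
    using G by (simp add: finite_simple_graph_def)
  ultimately obtain W where W: "?C \<subseteq> W" "W \<subseteq> verts G" "difunctional G W"
    and max: "\<And>U. W \<subseteq> U \<Longrightarrow> U \<subseteq> verts G \<Longrightarrow> difunctional G U \<Longrightarrow> W = U"
    using C finite_has_maximal2[of "{U. U \<subseteq> verts G \<and> difunctional G U}" ?C]
    unfolding mem_Collect_eq Bex_def Ball_def by metis
  have "W \<noteq> verts G" using W(3) nd by metis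
  then obtain b where b: "b \<in> verts G - W" using W(2) by (meson psubsetI psubset_imp_ex_mem)
  have "\<exists>u ps v. bypass G W u ps v"
  proof (rule ccontr)
    assume nb: "\<nexists>u ps v. bypass G W u ps v"
    obtain U V where UV: "separation G U V" "b \<notin> V" "W \<subseteq> V"
      by (rule separation_or_bypass[OF G b nb W(2)]) (rule that)
    \<comment> \<open>\<open>V\<close> contains the non-adjacent pair \<open>a\<close>, \<open>p\<close>, whereas \<open>U \<inter> V\<close> is a clique.\<close>
    have "U \<noteq> verts G"
    proof
      assume "U = verts G"
      moreover from this have "U \<inter> V = V" using UV(1) by (auto simp: separation_def)
      ultimately have "clique G V" using UV(1) by (simp add: separation_def)
      moreover have "a \<in> V" "p \<in> V" using W(1) UV(3) by auto
      ultimately show False using N(1) unfolding clique_def nonadj_def by blast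
    qed
    then have "proper_separation G U V" using UV b by (auto simp: proper_separation_def)
    then show False using no by blast
  qed
  then obtain u ps v where "shortest_bypass G W u ps v"
    using shortest_bypass_exists[OF G] by metis
  then interpret shortest_bypass G W u ps v .
  obtain x y where xy: "x \<in> W" "y \<in> W" "nonadj G x y" "apart G u v x y"
    using apart_edge_exists[OF W(3), of a p r s u v] N W(1) bypass_facts(1-3) by auto
  have m: "m = 1" by (rule single_vertex_if_apart_edge[OF free xy])
  let ?w = "ps ! 0"
  have "adjacent G u ?w" "adjacent G ?w v" using bypass_facts(6,7) m by simp_all
  then have "added_vertex G W ?w u v x y"
    using free W(3) bypass_facts(1-3) xy
    by unfold_locales (auto simp: nonadj_def adjacent_commute)
  then have "difunctional G (insert ?w W)" by (rule added_vertex.difunctional_insert)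
  then show False using max[of "insert ?w W"] outside[of 0] m W(2) by auto
qed

lemma is_clique_sum_separation:
  assumes G: "finite_simple_graph G" and sep: "separation G U V"
  shows "is_clique_sum (induced_subgraph G U) (induced_subgraph G V) G"
proof -
  have image: "graph_image id H = H" for H :: "'a graph"
    by (simp add: graph_image_def)
  have "e \<subseteq> U \<or> e \<subseteq> V" if "e \<in> edges G" for e
  proof -
    have "card e = 2" using that G by (simp add: finite_simple_graph_def)
    then obtain s t where e: "e = {s, t}" by (auto simp: card_2_iff)
    then have "adjacent G s t" "adjacent G t s"
      using that by (auto simp: adjacent_def insert_commute)
    then show ?thesis
      using adjacentD[OF G \<open>adjacent G s t\<close>] sep e unfolding separation_def by blast
  qed
  then have "edges G = {e \<in> edges G. e \<subseteq> U} \<union> {e \<in> edges G. e \<subseteq> V}" by blast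
  then have union: "G = graph_union (induced_subgraph G U) (induced_subgraph G V)"
    using sep by (cases G) (simp add: graph_union_def induced_subgraph_def separation_def)
  have clq: "clique (induced_subgraph G U) (U \<inter> V)" "clique (induced_subgraph G V) (U \<inter> V)"
    using sep by (auto simp: separation_def clique_def adjacent_induced_subgraph)
  show ?thesis
    unfolding is_clique_sum_def
    by (intro exI[of _ "U \<inter> V"] exI[of _ id]) (use clq union in \<open>simp add: image\<close>)
qed

lemma obstruction_free_induced_subgraph:
  assumes "obstruction_free G" "S \<subseteq> verts G"
  shows "obstruction_free (induced_subgraph G S)"
proof -
  have "induces G xs R" if i: "induces (induced_subgraph G S) xs R" for xs R
  proof -
    have "xs ! i \<in> S" if "i < length xs" for i
      using i nth_mem[OF that] by (auto simp: induces_def)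
    then show ?thesis
      using i assms(2) by (auto simp: induces_def adjacent_induced_subgraph)
  qed
  then show ?thesis using assms(1) unfolding obstruction_free_def by blast
qed

lemma obstruction_free_imp_clique_sum:
  assumes "finite_simple_graph G" "obstruction_free G"
  shows "G \<in> clique_sums F_all"
  using assms
proof (induction "card (verts G)" arbitrary: G rule: less_induct)
  case less
  note G = less.prems(1)
  show ?case
  proof (cases "difunctional G (verts G)")
    case True
    then show ?thesis using F_all_iff_difunctional[OF G] clique_sums.single by blast
  next
    case False
    then obtain U V where UV: "proper_separation G U V"
      using proper_separation_exists less.prems by blast
    then have sep: "separation G U V" and "U \<subset> verts G" "V \<subset> verts G"
      by (auto simp: proper_separation_def separation_def)
    have "induced_subgraph G S \<in> clique_sums F_all" if S: "S \<subset> verts G" for S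
    proof (rule less.hyps)
      show "card (verts (induced_subgraph G S)) < card (verts G)"
        using G S by (simp add: finite_simple_graph_def psubset_card_mono)
      show "finite_simple_graph (induced_subgraph G S)"
        using finite_simple_induced_subgraph G S by blast
      show "obstruction_free (induced_subgraph G S)"
        using obstruction_free_induced_subgraph less.prems(2) S by blast
    qed
    from this[OF \<open>U \<subset> verts G\<close>] this[OF \<open>V \<subset> verts G\<close>] show ?thesis
      by (rule clique_sums.glue) (rule is_clique_sum_separation[OF G sep])
  qed
qed

theorem theorem1p4:
  fixes G :: "'a graph"
  assumes "finite_simple_graph G"
  shows "G \<in> clique_sums F_all \<longleftrightarrow>
    (\<forall>n\<ge>5. \<not> has_induced_subgraph G (cycle_graph n)) \<and>
    \<not> has_induced_subgraph G D1 \<and>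
    \<not> has_induced_subgraph G D2 \<and>
    \<not> has_induced_subgraph G D3 \<and>
    \<not> has_induced_subgraph G D4"
  unfolding obstruction_free_iff[OF assms, symmetric]
  using clique_sums_F_all_obstruction_free obstruction_free_imp_clique_sum[OF assms] by blast

end
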